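(* Let $G$ be a group of order $k\ge 2$, and let $M_k(\mathbb{C})$ be equipped with the $G$-crossed product grading. Let $c_k(n)=c_n^G(M_k(\mathbb{C}))$ be its $G$-graded $n$-codimension. Then, as $n\to\infty$, $$c_k(n)\sim \frac{k^{\frac{k}{2}+1}}{(4\pi)^{\frac{k-1}{2}}}\; n^{-\frac{k-1}{2}}\; k^{2n},$$ i.e. the ratio of the two sides tends to $1$.
   Context: Crossed product grading: let $G$ be a finite group of order $k$, and index the rows and columns of $k\times k$ matrices by the elements of $G$ (with respect to some ordering of $G$). Let $e_h$ ($h\in G$) be the diagonal matrix unit at position $(h,h)$, and let $D_k$ be the set of diagonal matrices in $M_k(\mathbb{C})$. For $g\in G$ let $P_g$ be the permutation matrix sending the standard basis vector indexed by $h$ to the one indexed by $gh$; thus $P_gP_h=P_{gh}$, and $P_g\left(\sum_h a_he_h\right)P_g^{-1}=\sum_h a_he_{gh}$. The $G$-crossed product grading is $M_k(\mathbb{C})=\bigoplus_{g\in G}D_kP_g$, with $g$-component $D_kP_g$. Graded identities: let $\mathbb{Q}\langle X^G\rangle$ be the free associative algebra over $\mathbb{Q}$ on the noncommuting variables $x_{i,g}$, $i\ge1$, $g\in G$. A polynomial in it is a $G$-graded identity for $M_k(\mathbb{C})$ if it vanishes whenever each variable $x_{i,g}$ is replaced by an arbitrary element of $D_kP_g$. Let $\mathrm{Id}^G(M_k(\mathbb{C}))$ be the ideal of all such identities. Codimension: for $n\ge1$, $P_n^G$ is the $\mathbb{Q}$-span of all monomials $x_{i_1,g_1}x_{i_2,g_2}\cdots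 x_{i_n,g_n}$ with $\{i_1,\dots,i_n\}=\{1,\dots,n\}$ and $g_1,\dots,g_n\in G$ arbitrary, and $c_n^G(M_k(\mathbb{C}))=\dim_{\mathbb{Q}} P_n^G/(P_n^G\cap \mathrm{Id}^G(M_k(\mathbb{C})))$. *)

theory Defs
  imports
    Complex_Main
    "HOL-Library.Poly_Mapping"
    "HOL-Library.Landau_Symbols"
    "HOL-Algebra.AbelCoset"
    "HOL-Algebra.QuotRing"
    "Jordan_Normal_Form.Matrix"
    "Jordan_Normal_Form.VS_Connect"
begin

section \<open>Free associative algebras\<close>

text \<open>The free monoid on \<^typ>\<open>'x\<close>, written additively. With it, the convolution product of
  \<^theory>\<open>HOL-Library.Poly_Mapping\<close> makes \<open>'x fmonoid \<Rightarrow>\<^sub>0 rat\<close> the free associative unital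
  \<open>\<rat>\<close>-algebra on \<^typ>\<open>'x\<close>.\<close>

datatype 'x fmonoid = Word (letters: "'x list")

instantiation fmonoid :: (type) monoid_add
begin

definition zero_fmonoid :: "'a fmonoid" where
  "0 = Word []"

definition plus_fmonoid :: "'a fmonoid \<Rightarrow> 'a fmonoid \<Rightarrow> 'a fmonoid" where
  "v + w = Word (letters v @ letters w)"

instance
  by standard (auto simp: zero_fmonoid_def plus_fmonoid_def)

end

definition fvar :: "'x \<Rightarrow> 'x fmonoid \<Rightarrow>\<^sub>0 rat" where
  "fvar x = Poly_Mapping.single (Word [x]) 1"

definition free_algebra :: "'x set \<Rightarrow> (rat, 'x fmonoid \<Rightarrow>\<^sub>0 rat) module" where
  "free_algebra X =
    \<lparr>carrier = {f. \<forall>w \<in> Poly_Mapping.keys f. set (letters w) \<subseteq> X},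
     mult = (*), one = 1, zero = 0, add = (+),
     smult = (\<lambda>c. Poly_Mapping.map ((*) c))\<rparr>"

definition subst_mat ::
    "nat \<Rightarrow> ('x \<Rightarrow> complex mat) \<Rightarrow> ('x fmonoid \<Rightarrow>\<^sub>0 rat) \<Rightarrow> complex mat" where
  "subst_mat k \<phi> f =
    finsum (ring_mat TYPE(complex) k ())
      (\<lambda>w. of_rat (Poly_Mapping.lookup f w) \<cdot>\<^sub>m foldr (\<lambda>x A. \<phi> x * A) (letters w) (1\<^sub>m k))
      (Poly_Mapping.keys f)"


section \<open>Quotient modules\<close>

text \<open>As for \<^const>\<open>FactRing\<close>, the scalar multiple of a coset is written without choosing
  a representative. The ring multiplication and unit of the record play no role for modules.\<close>

definition quotient_module :: "('r, 'v, 'm) module_scheme \<Rightarrow> 'v set \<Rightarrow> ('r, 'v set) module" where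
  "quotient_module M N =
    \<lparr>carrier = a_rcosets\<^bsub>M\<^esub> N,
     mult = undefined, one = undefined, zero = N, add = set_add M,
     smult = (\<lambda>c A. \<Union>v\<in>A. N +>\<^bsub>M\<^esub> (c \<odot>\<^bsub>M\<^esub> v))\<rparr>"

lemma quotient_module_vectorspace:
  assumes vs: "vectorspace K V" and sub: "submodule K N V"
  shows "vectorspace K (quotient_module V N)"
proof -
  interpret V: vectorspace K V by fact
  interpret N: submodule K N V by fact
  have neg: "\<ominus>\<^bsub>V\<^esub> x \<in> N" if "x \<in> N" for x
    using that N.smult_closed[of "\<ominus>\<^bsub>K\<^esub> \<one>\<^bsub>K\<^esub>" x] N.subset
    by (metis V.R.add.inv_closed V.R.one_closed V.smult_minus_1 subsetD)
  have "subgroup N (add_monoid V)"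
  proof (rule V.M.add.subgroupI)
    show "N \<noteq> {}"
      using N.zero_closed by blast
    show "\<ominus>\<^bsub>V\<^esub> x \<in> N" if "x \<in> N" for x
      using neg[OF that] .
  qed (use N.subset N.m_closed in simp_all)
  then have AS: "abelian_subgroup N V"
    by (intro abelian_subgroupI3 additive_subgroup.intro) (auto intro: V.M.abelian_group_axioms)
  interpret A: abelian_subgroup N V by fact
  let ?Q = "quotient_module V N"
  have sm: "(\<Union>v\<in>N +>\<^bsub>V\<^esub> x. N +>\<^bsub>V\<^esub> (c \<odot>\<^bsub>V\<^esub> v)) = N +>\<^bsub>V\<^esub> (c \<odot>\<^bsub>V\<^esub> x)"
    if "c \<in> carrier K" "x \<in> carrier V" for c x
  proof -
    have "N +>\<^bsub>V\<^esub> (c \<odot>\<^bsub>V\<^esub> v) = N +>\<^bsub>V\<^esub> (c \<odot>\<^bsub>V\<^esub> x)" if v: "v \<in> N +>\<^bsub>V\<^esub> x" for v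
    proof -
      from v obtain n where n: "n \<in> N" "v = n \<oplus>\<^bsub>V\<^esub> x" by (auto simp: a_r_coset_def')
      have "c \<odot>\<^bsub>V\<^esub> v = c \<odot>\<^bsub>V\<^esub> n \<oplus>\<^bsub>V\<^esub> c \<odot>\<^bsub>V\<^esub> x"
        using n that \<open>c \<in> _\<close> \<open>x \<in> _\<close> N.subset by (auto intro: V.smult_r_distr)
      then have "c \<odot>\<^bsub>V\<^esub> v \<in> N +>\<^bsub>V\<^esub> (c \<odot>\<^bsub>V\<^esub> x)"
        using n N.smult_closed \<open>c \<in> _\<close> by (auto simp: a_r_coset_def')
      then show ?thesis using A.a_repr_independence'[of "c \<odot>\<^bsub>V\<^esub> v" "c \<odot>\<^bsub>V\<^esub> x"] that \<open>c \<in> _\<close> \<open>x \<in> _\<close> by auto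
    qed
    moreover have "x \<in> N +>\<^bsub>V\<^esub> x" using A.a_rcos_self that by auto
    ultimately show ?thesis by blast
  qed
  define q where "q x = N +>\<^bsub>V\<^esub> x" for x
  have car: "carrier ?Q = q ` carrier V"
    by (auto simp: q_def quotient_module_def A_RCOSETS_def')
  have zero: "\<zero>\<^bsub>?Q\<^esub> = q \<zero>\<^bsub>V\<^esub>"
    using N.subset by (simp add: q_def quotient_module_def)
  have add: "q x \<oplus>\<^bsub>?Q\<^esub> q y = q (x \<oplus>\<^bsub>V\<^esub> y)" if "x \<in> carrier V" "y \<in> carrier V" for x y
    using A.a_rcos_sum[OF that] by (simp add: q_def quotient_module_def)
  have smult: "c \<odot>\<^bsub>?Q\<^esub> q x = q (c \<odot>\<^bsub>V\<^esub> x)" if "c \<in> carrier K" "x \<in> carrier V" for c x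
    using sm[OF that] by (simp add: q_def quotient_module_def)
  have neg': "q x \<oplus>\<^bsub>?Q\<^esub> q (\<ominus>\<^bsub>V\<^esub> x) = \<zero>\<^bsub>?Q\<^esub>" if "x \<in> carrier V" for x
    using that by (simp add: add zero V.M.r_neg)
  have "module K ?Q"
  proof (rule module_criteria)
    show "cring K"
      by (rule V.R.is_cring)
    show "\<zero>\<^bsub>?Q\<^esub> \<in> carrier ?Q"
      unfolding car zero by (rule imageI) (rule V.M.zero_closed)
    show "\<forall>v w. v \<in> carrier ?Q \<and> w \<in> carrier ?Q \<longrightarrow> v \<oplus>\<^bsub>?Q\<^esub> w \<in> carrier ?Q"
      unfolding car by (clarify, simp only: add, intro imageI V.M.a_closed)
    show "\<forall>v\<in>carrier ?Q. \<exists>v'\<in>carrier ?Q. v \<oplus>\<^bsub>?Q\<^esub> v' = \<zero>\<^bsub>?Q\<^esub>"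
      unfolding car
    proof clarify
      fix x assume "x \<in> carrier V"
      then show "\<exists>v'\<in>q ` carrier V. q x \<oplus>\<^bsub>?Q\<^esub> v' = \<zero>\<^bsub>?Q\<^esub>"
        by (intro bexI[where x = "q (\<ominus>\<^bsub>V\<^esub> x)"] neg' imageI V.M.a_inv_closed)
    qed
    show "\<forall>c v. c \<in> carrier K \<and> v \<in> carrier ?Q \<longrightarrow> c \<odot>\<^bsub>?Q\<^esub> v \<in> carrier ?Q"
      unfolding car by (clarify, simp only: smult, intro imageI V.smult_closed)
    show "\<forall>v w. v \<in> carrier ?Q \<and> w \<in> carrier ?Q \<longrightarrow> v \<oplus>\<^bsub>?Q\<^esub> w = w \<oplus>\<^bsub>?Q\<^esub> v"
      unfolding car by (clarify, simp only: add V.M.a_comm)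
    show "\<forall>v w x. v \<in> carrier ?Q \<and> w \<in> carrier ?Q \<and> x \<in> carrier ?Q
        \<longrightarrow> (v \<oplus>\<^bsub>?Q\<^esub> w) \<oplus>\<^bsub>?Q\<^esub> x = v \<oplus>\<^bsub>?Q\<^esub> (w \<oplus>\<^bsub>?Q\<^esub> x)"
      unfolding car by (clarify, simp only: add V.M.a_closed V.M.a_assoc)
    show "\<forall>v\<in>carrier ?Q. v \<oplus>\<^bsub>?Q\<^esub> \<zero>\<^bsub>?Q\<^esub> = v"
      unfolding car zero by (clarify, simp only: add V.M.zero_closed V.M.r_zero)
    show "\<forall>a b v. a \<in> carrier K \<and> b \<in> carrier K \<and> v \<in> carrier ?Q
        \<longrightarrow> (a \<otimes>\<^bsub>K\<^esub> b) \<odot>\<^bsub>?Q\<^esub> v = a \<odot>\<^bsub>?Q\<^esub> (b \<odot>\<^bsub>?Q\<^esub> v)"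
      unfolding car by (clarify, simp only: smult V.smult_closed V.R.m_closed V.smult_assoc1)
    show "\<forall>v\<in>carrier ?Q. \<one>\<^bsub>K\<^esub> \<odot>\<^bsub>?Q\<^esub> v = v"
      unfolding car by (clarify, simp only: smult V.R.one_closed V.smult_one)
    show "\<forall>a b v. a \<in> carrier K \<and> b \<in> carrier K \<and> v \<in> carrier ?Q
        \<longrightarrow> (a \<oplus>\<^bsub>K\<^esub> b) \<odot>\<^bsub>?Q\<^esub> v = (a \<odot>\<^bsub>?Q\<^esub> v) \<oplus>\<^bsub>?Q\<^esub> (b \<odot>\<^bsub>?Q\<^esub> v)"
      unfolding car by (clarify, simp only: smult add V.smult_closed V.R.a_closed V.smult_l_distr)
    show "\<forall>a v w. a \<in> carrier K \<and> v \<in> carrier ?Q \<and> w \<in> carrier ?Q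
        \<longrightarrow> a \<odot>\<^bsub>?Q\<^esub> (v \<oplus>\<^bsub>?Q\<^esub> w) = (a \<odot>\<^bsub>?Q\<^esub> v) \<oplus>\<^bsub>?Q\<^esub> (a \<odot>\<^bsub>?Q\<^esub> w)"
      unfolding car by (clarify, simp only: smult add V.smult_closed V.M.a_closed V.smult_r_distr)
  qed
  then show ?thesis using vectorspace.intro V.field_axioms by blast
qed


section \<open>The crossed product grading and its graded codimensions\<close>

text \<open>In the following, \<open>e\<close> enumerates the elements of \<open>G\<close>: row and column \<open>i < order G\<close> of a
  matrix carry the index \<open>e i\<close>.\<close>

definition perm_mat :: "('g, 'b) monoid_scheme \<Rightarrow> (nat \<Rightarrow> 'g) \<Rightarrow> 'g \<Rightarrow> complex mat" where
  "perm_mat G e g =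
    mat (Coset.order G) (Coset.order G) (\<lambda>(i, j). if e i = g \<otimes>\<^bsub>G\<^esub> e j then 1 else 0)"

definition diag_mats :: "nat \<Rightarrow> complex mat set" where
  "diag_mats k = {A \<in> carrier_mat k k. diagonal_mat A}"

definition crossed_component ::
    "('g, 'b) monoid_scheme \<Rightarrow> (nat \<Rightarrow> 'g) \<Rightarrow> 'g \<Rightarrow> complex mat set" where
  "crossed_component G e g = (\<lambda>A. A * perm_mat G e g) ` diag_mats (Coset.order G)"

text \<open>The pair \<open>(i, g)\<close> stands for the variable \<open>x\<^sub>i\<^sub>,\<^sub>g\<close>.\<close>

definition graded_vars :: "('g, 'b) monoid_scheme \<Rightarrow> (nat \<times> 'g) set" where
  "graded_vars G = {1..} \<times> carrier G"

definition graded_identities ::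
    "('g, 'b) monoid_scheme \<Rightarrow> (nat \<Rightarrow> 'g) \<Rightarrow> ((nat \<times> 'g) fmonoid \<Rightarrow>\<^sub>0 rat) set" where
  "graded_identities G e =
    {f \<in> carrier (free_algebra (graded_vars G)).
      \<forall>\<phi>. (\<forall>(i, g) \<in> graded_vars G. \<phi> (i, g) \<in> crossed_component G e g)
          \<longrightarrow> subst_mat (Coset.order G) \<phi> f = 0\<^sub>m (Coset.order G) (Coset.order G)}"

text \<open>A list of length \<open>n\<close> whose set of first components is \<open>{1..n}\<close> has each of
  \<open>1, \<dots>, n\<close> exactly once as a first component.\<close>

definition multilinear_monomials ::
    "('g, 'b) monoid_scheme \<Rightarrow> nat \<Rightarrow> ((nat \<times> 'g) fmonoid \<Rightarrow>\<^sub>0 rat) set" where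
  "multilinear_monomials G n =
    {prod_list (map fvar xs) | xs.
      length xs = n \<and> fst ` set xs = {1..n} \<and> snd ` set xs \<subseteq> carrier G}"

definition multilinear_space ::
    "('g, 'b) monoid_scheme \<Rightarrow> nat \<Rightarrow> ((nat \<times> 'g) fmonoid \<Rightarrow>\<^sub>0 rat) set" where
  "multilinear_space G n =
    LinearCombinations.module.span class_ring (free_algebra (graded_vars G))
      (multilinear_monomials G n)"

definition graded_codim :: "('g, 'b) monoid_scheme \<Rightarrow> (nat \<Rightarrow> 'g) \<Rightarrow> nat \<Rightarrow> nat" where
  "graded_codim G e n =
    vectorspace.dim class_ring
      (quotient_module
        ((free_algebra (graded_vars G))\<lparr>carrier := multilinear_space G n\<rparr>)
        (multilinear_space G n \<inter> graded_identities G e))"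

end

theory Submission
  imports
    Defs
    "HOL-Probability.Probability"
    "HOL-Real_Asymp.Real_Asymp"
    "Graph_Theory.Euler"
begin

text \<open>
  Let a word \<open>x\<^sub>i\<^sub>1\<^sub>,\<^sub>g\<^sub>1 \<dots> x\<^sub>i\<^sub>n\<^sub>,\<^sub>g\<^sub>n\<close> act on row \<open>v\<close> of a matrix: each factor from \<open>D\<^sub>k P\<^sub>g\<close> moves from row \<open>v\<close>
  to row \<open>g\<^sup>-\<^sup>1v\<close> and contributes one freely chosen scalar, which depends on the variable and on \<open>v\<close>. So
  the word is a walk in \<open>G\<close> that starts at \<open>1\<close>, and the variable with index \<open>i\<close> labels one step of it, an
  arc \<open>u\<^sub>i \<rightarrow> w\<^sub>i\<close> with \<open>u\<^sub>i w\<^sub>i\<^sup>-\<^sup>1\<close> the degree of the variable. The value of the word under a graded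
  substitution depends only on the map \<open>i \<mapsto> (u\<^sub>i, w\<^sub>i)\<close>: the entry is the product of the scalars at these
  arcs (translated by \<open>v\<close> for the other rows), and the degrees of the vertices determine where the walk
  ends. Conversely the substitution that puts \<open>1\<close> at the arcs of a given map and \<open>0\<close> elsewhere
  separates that map from all others. Hence the codimension is the number of digraphs on the vertex
  set \<open>G\<close> with arcs labelled \<open>1, \<dots>, n\<close> that have an Eulerian trail starting at \<open>1\<close>
  (\<open>graded_codim_eq_card_eulerian\<close>).

  To count them, close the trail by an arc labelled \<open>0\<close> that leads back to \<open>1\<close>. The result is a
  balanced digraph with \<open>n + 1\<close> arcs in which arc \<open>0\<close> has head \<open>1\<close>. By Euler's theorem every such
  digraph arises if it is connected, and it certainly is if all \<open>k\<^sup>2\<close> pairs of vertices occur as arcs; the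
  digraphs that miss a pair number at most \<open>k\<^sup>2 (k\<^sup>2 - 1)\<^sup>n\<^sup>+\<^sup>1\<close>, which is negligible. By symmetry in the
  vertices, the balanced digraphs with prescribed head of arc \<open>0\<close> are exactly one \<open>k\<close>-th of all balanced
  digraphs (\<open>card_eulerian_digraphs_bounds\<close>). A balanced digraph with \<open>N\<close> arcs is a pair of words of
  length \<open>N\<close> (the tails and the heads) in which each letter occurs equally often, so there
  are \<open>M\<^sub>k(N) = \<Sum> (N! / (m\<^sub>1! \<dots> m\<^sub>k!))\<^sup>2\<close> of them, the sum being over \<open>m\<^sub>1 + \<dots> + m\<^sub>k = N\<close>.

  It remains to show \<open>M\<^sub>k(N) \<sim> k\<^sup>k\<^sup>/\<^sup>2 (4\<pi>N)\<^sup>-\<^sup>(\<^sup>k\<^sup>-\<^sup>1\<^sup>)\<^sup>/\<^sup>2 k\<^sup>2\<^sup>N\<close> (\<open>sum_sq_multinom_tendsto\<close>). Splitting off one letter gives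
  \<open>M\<^sub>k\<^sub>+\<^sub>1(N) = \<Sum>\<^sub>j (N choose j)\<^sup>2 M\<^sub>k(j)\<close>. After division by \<open>(k+1)\<^sup>2\<^sup>N\<close> this becomes a sum
  of \<open>b(j)\<^sup>2 M\<^sub>k(j) / k\<^sup>2\<^sup>j\<close>, where \<open>b\<close> are the binomial probabilities for \<open>p = k/(k+1)\<close>. They concentrate
  at \<open>j \<approx> pN\<close>, while the other factor is asymptotic to a power of \<open>j\<close>; so the induction step needs
  only \<open>\<Sum>\<^sub>j b(j)\<^sup>2 \<sim> (4\<pi>Np(1-p))\<^sup>-\<^sup>1\<^sup>/\<^sup>2\<close>, which Parseval's identity turns into a Gaussian integral
  (\<open>sum_sq_bin_prob_tendsto\<close>).
\<close>

section \<open>Sums of squares of binomial probabilities\<close>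



text \<open>Any quadratic lower bound on the whole period yields an integrable majorant of Gaussian type. The
  constant comes from \<open>1 - cos x = 8 (sin y)\<^sup>2 (cos y)\<^sup>2\<close> for \<open>y = \<bar>x\<bar> / 4\<close>, where \<open>sin y \<ge> y / 2\<close> and \<open>(cos y)\<^sup>2 \<ge> 1 / 2\<close>.\<close>

lemma one_minus_cos_ge_square:
  fixes x :: real
  assumes "\<bar>x\<bar> \<le> pi"
  shows "x\<^sup>2 / 16 \<le> 1 - cos x"
proof -
  have sin_ge: "y / 2 \<le> sin y" if "0 \<le> y" "y \<le> pi / 4" for y :: real
  proof -
    have "(\<lambda>t. sin t - t / 2) 0 \<le> (\<lambda>t. sin t - t / 2) y"
    proof (rule DERIV_nonneg_imp_nondecreasing[OF that(1)])
      fix t :: real assume t: "0 \<le> t" "t \<le> y"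
      have "cos (pi / 3) \<le> cos t"
        using t that by (intro cos_monotone_0_pi_le) auto
      then show "\<exists>d. ((\<lambda>t. sin t - t / 2) has_real_derivative d) (at t) \<and> 0 \<le> d"
        by (intro exI[of _ "cos t - 1 / 2"]) (auto intro!: derivative_eq_intros simp: cos_60)
    qed
    then show ?thesis by simp
  qed
  define y where "y = \<bar>x\<bar> / 4"
  have y: "0 \<le> y" "y \<le> pi / 4" using assms by (auto simp: y_def)
  have "(y / 2)\<^sup>2 \<le> (sin y)\<^sup>2"
    using sin_ge[OF y] y by (intro power_mono) auto
  moreover have "1 / 2 \<le> (cos y)\<^sup>2"
  proof -
    have "cos (pi / 4) \<le> cos y" using y by (intro cos_monotone_0_pi_le) auto
    then have "(cos (pi / 4))\<^sup>2 \<le> (cos y)\<^sup>2"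
      by (intro power_mono) (auto simp: cos_45)
    then show ?thesis by (simp add: cos_45 power_divide)
  qed
  ultimately have "(y / 2)\<^sup>2 * (1 / 2) \<le> (sin y)\<^sup>2 * (cos y)\<^sup>2"
    by (intro mult_mono) auto
  moreover have "1 - cos x = 8 * ((sin y)\<^sup>2 * (cos y)\<^sup>2)"
  proof -
    have "cos x = cos (2 * (2 * y))" by (simp add: y_def)
    also have "\<dots> = 1 - 2 * (sin (2 * y))\<^sup>2" by (rule cos_double_sin)
    finally show ?thesis by (simp add: sin_double power_mult_distrib)
  qed
  ultimately show ?thesis by (simp add: y_def power2_eq_square)
qed

lemma integral_cos_period:
  fixes m :: int
  shows "((\<lambda>\<theta>. cos (of_int m * \<theta>)) has_integral (if m = 0 then 2 * pi else 0)) {-pi..pi}"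
proof (cases "m = 0")
  case True
  then show ?thesis using has_integral_const_real[of "1::real" "-pi" pi] by simp
next
  case False
  have "((\<lambda>\<theta>. cos (of_int m * \<theta>)) has_integral
      (sin (of_int m * pi) / of_int m - sin (of_int m * (-pi)) / of_int m)) {-pi..pi}"
    using False
    by (intro fundamental_theorem_of_calculus)
       (auto intro!: derivative_eq_intros simp flip: has_real_derivative_iff_has_vector_derivative)
  moreover have "sin (of_int m * pi) = 0" by (auto simp: sin_zero_iff_int2)
  ultimately show ?thesis using False by simp
qed

definition bin_prob :: "nat \<Rightarrow> real \<Rightarrow> nat \<Rightarrow> real" where
  "bin_prob n p j = real (n choose j) * p ^ j * (1 - p) ^ (n - j)"

text \<open>Parseval's identity for the trigonometric polynomial \<open>(1 - p + p e\<^sup>i\<^sup>\<theta>)\<^sup>n = \<Sum>\<^sub>j b\<^sub>j e\<^sup>i\<^sup>j\<^sup>\<theta>\<close>, whose squared absolute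
  value is the integrand.\<close>

lemma sum_sq_bin_prob_integral:
  fixes p :: real
  shows "((\<lambda>\<theta>. (1 - 2 * p * (1 - p) * (1 - cos \<theta>)) ^ n) has_integral
            2 * pi * (\<Sum>j\<le>n. (bin_prob n p j)\<^sup>2)) {-pi..pi}"
proof -
  let ?b = "bin_prob n p"
  have eq: "(1 - 2 * p * (1 - p) * (1 - cos \<theta>)) ^ n
      = (\<Sum>i\<le>n. \<Sum>j\<le>n. ?b i * ?b j * cos (of_int (int i - int j) * \<theta>))" for \<theta>
  proof -
    define z where "z = (of_real (1 - p) + of_real p * cis \<theta> :: complex)"
    have z: "z ^ n = (\<Sum>j\<le>n. of_real (?b j) * cis (real j * \<theta>))"
    proof -
      have "z ^ n = (of_real p * cis \<theta> + of_real (1 - p)) ^ n"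
        by (simp only: z_def add.commute)
      also have "\<dots> = (\<Sum>j\<le>n. of_real (?b j) * cis (real j * \<theta>))"
        unfolding binomial_ring
        by (intro sum.cong refl)
           (simp add: bin_prob_def power_mult_distrib Complex.DeMoivre mult_ac)
      finally show ?thesis .
    qed
    have "(1 - 2 * p * (1 - p) * (1 - cos \<theta>)) = (cmod z)\<^sup>2"
    proof -
      have "(cmod z)\<^sup>2 = (1 - p + p * cos \<theta>)\<^sup>2 + (p * sin \<theta>)\<^sup>2"
        by (simp add: z_def cmod_power2)
      also have "\<dots> = (1 - p)\<^sup>2 + 2 * p * (1 - p) * cos \<theta> + p\<^sup>2 * ((sin \<theta>)\<^sup>2 + (cos \<theta>)\<^sup>2)"
        by (simp add: power2_eq_square algebra_simps del: sin_cos_squared_add3)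
      also have "\<dots> = (1 - p)\<^sup>2 + 2 * p * (1 - p) * cos \<theta> + p\<^sup>2" by simp
      finally show ?thesis by (simp add: power2_eq_square algebra_simps)
    qed
    then have "(1 - 2 * p * (1 - p) * (1 - cos \<theta>)) ^ n = (cmod (z ^ n))\<^sup>2"
      by (simp add: norm_power power_mult[symmetric] mult.commute)
    also have "\<dots> = Re (z ^ n * cnj (z ^ n))"
      by (metis Re_complex_of_real complex_norm_square)
    also have "z ^ n * cnj (z ^ n) = (\<Sum>i\<le>n. \<Sum>j\<le>n. of_real (?b i * ?b j) * cis (of_int (int i - int j) * \<theta>))"
      unfolding z cnj_sum sum_product
      by (intro sum.cong refl) (simp add: cis_cnj cis_mult left_diff_distrib)
    finally show ?thesis by simp
  qed
  have "((\<lambda>\<theta>. \<Sum>i\<le>n. \<Sum>j\<le>n. ?b i * ?b j * cos (of_int (int i - int j) * \<theta>)) has_integral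
      (\<Sum>i\<le>n. \<Sum>j\<le>n. ?b i * ?b j * (if int i - int j = 0 then 2 * pi else 0))) {-pi..pi}"
    by (intro has_integral_sum has_integral_mult_right integral_cos_period) auto
  also have "(\<Sum>i\<le>n. \<Sum>j\<le>n. ?b i * ?b j * (if int i - int j = 0 then 2 * pi else 0))
     = 2 * pi * (\<Sum>j\<le>n. (?b j)\<^sup>2)"
    by (simp add: if_distrib sum_distrib_left power2_eq_square mult_ac cong: if_cong)
  finally show ?thesis by (simp only: eq)
qed

lemma has_integral_gaussian:
  fixes c :: real
  assumes "c > 0"
  shows "has_bochner_integral lborel (\<lambda>t. exp (- c * t\<^sup>2)) (sqrt (pi / c))"
proof -
  define s where "s = sqrt (1 / (2 * c))"
  have s: "s > 0" "s\<^sup>2 = 1 / (2 * c)" using assms by (auto simp: s_def)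
  have "has_bochner_integral lborel (\<lambda>t. sqrt (pi / c) * normal_density 0 s t) (sqrt (pi / c) * 1)"
    using s by (intro has_bochner_integral_mult_right) (auto simp: has_bochner_integral_iff)
  moreover have "sqrt (pi / c) * normal_density 0 s t = exp (- c * t\<^sup>2)" for t
    using assms by (simp add: normal_density_def s real_sqrt_divide)
  ultimately show ?thesis by simp
qed

text \<open>Laplace's method: substituting \<open>\<theta> = t / sqrt n\<close> in the Parseval integral makes the integrand converge
  to \<open>exp (- p (1 - p) t\<^sup>2)\<close>.\<close>

lemma sum_sq_bin_prob_tendsto:
  fixes p :: real
  assumes p: "0 < p" "p < 1"
  shows "(\<lambda>n. sqrt (real n) * (\<Sum>j\<le>n. (bin_prob n p j)\<^sup>2)) \<longlonglongrightarrow> 1 / sqrt (4 * pi * p * (1 - p))"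
proof -
  define c where "c = p * (1 - p)"
  have c: "0 < c" "c \<le> 1 / 4"
  proof -
    have "0 \<le> (p - 1/2)\<^sup>2" by simp
    then show "c \<le> 1 / 4" by (simp add: c_def power2_eq_square algebra_simps)
  qed (use p in \<open>simp add: c_def\<close>)
  define f where "f n \<theta> = indicator {-pi..pi} \<theta> * (1 - 2 * c * (1 - cos \<theta>)) ^ n" for n :: nat and \<theta> :: real
  have base: "0 \<le> 1 - 2 * c * (1 - cos \<theta>)" for \<theta>
  proof -
    have "2 * c * (1 - cos \<theta>) \<le> (2 * (1/4)) * 2"
      using c cos_ge_minus_one[of \<theta>] by (intro mult_mono) auto
    then show ?thesis by simp
  qed
  have f_int: "integral\<^sup>L lborel (f n) = 2 * pi * (\<Sum>j\<le>n. (bin_prob n p j)\<^sup>2)" for n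
  proof -
    have "set_integrable lborel {-pi..pi} (\<lambda>\<theta>. (1 - 2 * c * (1 - cos \<theta>)) ^ n)"
      by (intro borel_integrable_compact[OF compact_Icc, folded set_integrable_def] continuous_intros)
    from set_borel_integral_eq_integral(2)[OF this] sum_sq_bin_prob_integral[of p n]
    show ?thesis
      by (simp add: set_lebesgue_integral_def f_def[abs_def] c_def integral_unique mult.assoc)
  qed
  have scaled: "integral\<^sup>L lborel (\<lambda>t. f n (t / sqrt n)) = sqrt n * (2 * pi * (\<Sum>j\<le>n. (bin_prob n p j)\<^sup>2))"
    if "n > 0" for n
    using lborel_integral_real_affine[of "1 / sqrt n" "f n" 0] that f_int[of n]
    by (simp add: field_simps)
  \<comment> \<open>The index is shifted because there is no majorant for \<open>n = 0\<close>: as \<open>t / 0 = 0\<close>, that integrand is constantly \<open>1\<close>.\<close>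
  have "(\<lambda>n. integral\<^sup>L lborel (\<lambda>t. f (Suc n) (t / sqrt (Suc n))))
      \<longlonglongrightarrow> integral\<^sup>L lborel (\<lambda>t. exp (- c * t\<^sup>2))"
  proof (rule integral_dominated_convergence[where w = "\<lambda>t. exp (- (c / 8) * t\<^sup>2)"])
    show "integrable lborel (\<lambda>t. exp (- (c / 8) * t\<^sup>2))"
      using has_integral_gaussian[of "c / 8"] c by (auto simp: has_bochner_integral_iff)
    show "AE t in lborel. norm (f (Suc n) (t / sqrt (Suc n))) \<le> exp (- (c / 8) * t\<^sup>2)" for n
    proof (intro AE_I2)
      fix t :: real
      define \<theta> where "\<theta> = t / sqrt (Suc n)"
      show "norm (f (Suc n) (t / sqrt (Suc n))) \<le> exp (- (c / 8) * t\<^sup>2)"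
      proof (cases "\<theta> \<in> {-pi..pi}")
        case True
        have "1 - 2 * c * (1 - cos \<theta>) \<le> exp (- 2 * c * (1 - cos \<theta>))"
          using exp_ge_add_one_self[of "- 2 * c * (1 - cos \<theta>)"] by simp
        also have "\<dots> \<le> exp (- 2 * c * (\<theta>\<^sup>2 / 16))"
          using one_minus_cos_ge_square[of \<theta>] True c by (auto simp: abs_le_iff)
        finally have "(1 - 2 * c * (1 - cos \<theta>)) ^ Suc n \<le> exp (- 2 * c * (\<theta>\<^sup>2 / 16)) ^ Suc n"
          by (intro power_mono base)
        also have "\<dots> = exp (- (c / 8) * t\<^sup>2)"
        proof -
          have "real (Suc n) * \<theta>\<^sup>2 = t\<^sup>2" by (simp add: \<theta>_def power_divide)
          then have "real (Suc n) * (- 2 * c * (\<theta>\<^sup>2 / 16)) = - (c / 8) * t\<^sup>2"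
            by (simp add: algebra_simps)
          then show ?thesis by (metis exp_of_nat_mult)
        qed
        finally show ?thesis
          unfolding \<theta>_def[symmetric] f_def using base[of \<theta>] True by (simp del: power_Suc)
      next
        case False
        then show ?thesis unfolding \<theta>_def[symmetric] f_def by simp
      qed
    qed
    show "AE t in lborel. (\<lambda>n. f (Suc n) (t / sqrt (Suc n))) \<longlonglongrightarrow> exp (- c * t\<^sup>2)"
    proof (intro AE_I2)
      fix t :: real
      have "(\<lambda>n. (1 - 2 * c * (1 - cos (t / sqrt n))) ^ n) \<longlonglongrightarrow> exp (- (c * (t * t)))"
        using c by real_asymp
      then have "(\<lambda>n. (1 - 2 * c * (1 - cos (t / sqrt n))) ^ n) \<longlonglongrightarrow> exp (- c * t\<^sup>2)"
        by (simp add: power2_eq_square)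
      moreover have "(\<lambda>n. t / sqrt (real n)) \<longlonglongrightarrow> 0"
        by real_asymp
      then have "eventually (\<lambda>n. \<bar>t / sqrt n\<bar> < pi) sequentially"
        by (intro order_tendstoD(2)[OF tendsto_rabs_zero]) auto
      then have "eventually (\<lambda>n. (1 - 2 * c * (1 - cos (t / sqrt n))) ^ n = f n (t / sqrt n)) sequentially"
      proof eventually_elim
        case (elim n)
        then have "t / sqrt n \<in> {-pi..pi}" by (simp only: abs_less_iff atLeastAtMost_iff) linarith
        then show ?case by (simp add: f_def)
      qed
      ultimately have "(\<lambda>n. f n (t / sqrt n)) \<longlonglongrightarrow> exp (- c * t\<^sup>2)"
        by (rule Lim_transform_eventually)
      then show "(\<lambda>n. f (Suc n) (t / sqrt (Suc n))) \<longlonglongrightarrow> exp (- c * t\<^sup>2)"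
        by (rule LIMSEQ_Suc)
    qed
  qed (auto simp: f_def)
  then have "(\<lambda>n. integral\<^sup>L lborel (\<lambda>t. f n (t / sqrt n))) \<longlonglongrightarrow> integral\<^sup>L lborel (\<lambda>t. exp (- c * t\<^sup>2))"
    by (subst (asm) filterlim_sequentially_Suc)
  also have "integral\<^sup>L lborel (\<lambda>t. exp (- c * t\<^sup>2)) = sqrt (pi / c)"
    using has_integral_gaussian[OF c(1)] by (simp add: has_bochner_integral_iff)
  finally have "(\<lambda>n. integral\<^sup>L lborel (\<lambda>t. f n (t / sqrt n)) / (2 * pi)) \<longlonglongrightarrow> sqrt (pi / c) / (2 * pi)"
    by (intro tendsto_intros) auto
  moreover have "eventually (\<lambda>n. integral\<^sup>L lborel (\<lambda>t. f n (t / sqrt n)) / (2 * pi)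
      = sqrt n * (\<Sum>j\<le>n. (bin_prob n p j)\<^sup>2)) sequentially"
    using eventually_gt_at_top[of 0] by eventually_elim (simp add: scaled)
  ultimately have "(\<lambda>n. sqrt n * (\<Sum>j\<le>n. (bin_prob n p j)\<^sup>2)) \<longlonglongrightarrow> sqrt (pi / c) / (2 * pi)"
    by (rule Lim_transform_eventually)
  also have "sqrt (pi / c) / (2 * pi) = 1 / sqrt (4 * pi * p * (1 - p))"
  proof -
    have "x / y / (2 * (x * x)) = 1 / (2 * x * y)" if "x > 0" "y > 0" for x y :: real
      using that by (simp add: field_simps)
    from this[of "sqrt pi" "sqrt c"] have "sqrt (pi / c) / (2 * pi) = 1 / (2 * sqrt pi * sqrt c)"
      using c by (simp add: real_sqrt_divide)
    moreover have "sqrt (4 * pi * p * (1 - p)) = 2 * sqrt pi * sqrt c"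
      by (simp add: c_def real_sqrt_mult mult.assoc)
    ultimately show ?thesis by simp
  qed
  finally show ?thesis .
qed


lemma bin_prob_eq_pmf: "p \<in> {0..1} \<Longrightarrow> bin_prob n p j = pmf (binomial_pmf n p) j"
  by (simp add: bin_prob_def)

lemma bin_prob_nonneg: "p \<in> {0..1} \<Longrightarrow> 0 \<le> bin_prob n p j"
  by (simp add: bin_prob_def)

lemma bin_prob_le_1: "p \<in> {0..1} \<Longrightarrow> bin_prob n p j \<le> 1"
  by (simp only: bin_prob_eq_pmf pmf_le_1)

text \<open>Hoeffding's inequality.\<close>

lemma sum_bin_prob_tail_le:
  fixes p \<delta> :: real
  assumes "p \<in> {0..1}" "\<delta> \<ge> 0" "n > 0"
  shows "(\<Sum>j | j \<le> n \<and> \<bar>real j / real n - p\<bar> \<ge> \<delta>. bin_prob n p j) \<le> 2 * exp (- 2 * real n * \<delta>\<^sup>2)"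
proof -
  have fin: "finite {j. j \<le> n \<and> \<bar>real j / real n - p\<bar> \<ge> \<delta>}" by simp
  have "(\<Sum>j | j \<le> n \<and> \<bar>real j / real n - p\<bar> \<ge> \<delta>. bin_prob n p j)
      = measure_pmf.prob (binomial_pmf n p) {j. j \<le> n \<and> \<bar>real j / real n - p\<bar> \<ge> \<delta>}"
    using assms(1) fin by (simp add: measure_measure_pmf_finite bin_prob_eq_pmf)
  also have "\<dots> \<le> measure_pmf.prob (binomial_pmf n p) {j. \<bar>real j / real n - p\<bar> \<ge> \<delta>}"
    by (intro measure_pmf.finite_measure_mono) auto
  also have "\<dots> \<le> 2 * exp (- 2 * real n * \<delta>\<^sup>2)"
    using binomial_distribution.prob_abs_ge'[OF _ assms(3) assms(2), of p] assms(1)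
    by (simp add: binomial_distribution_def)
  finally show ?thesis .
qed

text \<open>The squared binomial probabilities sit at \<open>j \<approx> p n\<close>, where \<open>h j\<close> is close to \<open>C (p n) powr (- \<alpha>)\<close>. Hence
  the weight \<open>h\<close> can be taken out of the sum; the bound \<open>h \<le> 1\<close> controls the tails, which are
  exponentially small.\<close>

lemma sum_sq_bin_prob_weighted_tendsto:
  fixes p \<alpha> C :: real and h :: "nat \<Rightarrow> real"
  assumes p: "0 < p" "p < 1" and \<alpha>: "\<alpha> \<ge> 0"
    and h: "\<And>j. 0 \<le> h j" "\<And>j. h j \<le> 1"
    and lim: "(\<lambda>j. h j * real j powr \<alpha>) \<longlonglongrightarrow> C"
  shows "(\<lambda>n. (\<Sum>j\<le>n. (bin_prob n p j)\<^sup>2 * h j) * real n powr (\<alpha> + 1 / 2))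
           \<longlonglongrightarrow> C * p powr (- \<alpha>) / sqrt (4 * pi * p * (1 - p))"
proof -
  define L where "L = C * p powr (- \<alpha>)"
  define w where "w = 1 / sqrt (4 * pi * p * (1 - p))"
  define W where "W n = sqrt (real n) * (\<Sum>j\<le>n. (bin_prob n p j)\<^sup>2)" for n
  \<comment> \<open>The error of replacing \<open>h j\<close> by its limiting value; it suffices that it tends to \<open>0\<close>.\<close>
  define D where "D n = (\<Sum>j\<le>n. sqrt n * (bin_prob n p j)\<^sup>2 * (h j * real n powr \<alpha> - L))" for n
  have p': "p \<in> {0..1}" using p by simp
  have W: "W \<longlonglongrightarrow> w"
    unfolding W_def w_def by (rule sum_sq_bin_prob_tendsto[OF p])
  have W_nonneg: "0 \<le> W n" for n
    by (simp add: W_def sum_nonneg)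
  have w: "0 \<le> w" using p by (simp add: w_def)
  have near: "\<exists>\<delta>>0. eventually (\<lambda>n. \<forall>j\<le>n. \<bar>real j / real n - p\<bar> < \<delta> \<longrightarrow>
      \<bar>h j * real n powr \<alpha> - L\<bar> < \<epsilon>) sequentially" if \<epsilon>: "\<epsilon> > 0" for \<epsilon>
  proof -
    have "((\<lambda>z. snd z * fst z powr (- \<alpha>)) \<longlongrightarrow> C * p powr (- \<alpha>)) (nhds p \<times>\<^sub>F nhds C)"
      using p by (intro tendsto_intros filterlim_fst filterlim_snd) auto
    then have "eventually (\<lambda>z. dist (snd z * fst z powr (- \<alpha>)) L < \<epsilon>) (nhds p \<times>\<^sub>F nhds C)"
      unfolding L_def using \<epsilon> by (rule tendstoD)
    then obtain P Q where P: "eventually P (nhds p)" and Q: "eventually Q (nhds C)"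
      and PQ: "\<And>x y. P x \<Longrightarrow> Q y \<Longrightarrow> dist (y * x powr (- \<alpha>)) L < \<epsilon>"
      unfolding eventually_prod_filter by auto
    from P obtain d where d: "d > 0" "\<And>x. dist x p < d \<Longrightarrow> P x"
      by (auto simp: eventually_nhds_metric)
    have "eventually (\<lambda>j. Q (h j * real j powr \<alpha>)) sequentially"
      using lim Q by (simp add: filterlim_iff)
    then obtain J where J: "\<And>j. j \<ge> J \<Longrightarrow> Q (h j * real j powr \<alpha>)"
      by (auto simp: eventually_at_top_linorder)
    define \<delta> where "\<delta> = min d (p / 2)"
    have "eventually (\<lambda>n. real n * (p / 2) \<ge> real J + 1) sequentially"
      using p by real_asymp
    then have "eventually (\<lambda>n. \<forall>j\<le>n. \<bar>real j / real n - p\<bar> < \<delta> \<longrightarrow>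
        \<bar>h j * real n powr \<alpha> - L\<bar> < \<epsilon>) sequentially"
    proof eventually_elim
      case (elim n)
      then have n: "n > 0" by (cases n) auto
      show ?case
      proof (intro allI impI)
        fix j assume "j \<le> n" and close: "\<bar>real j / real n - p\<bar> < \<delta>"
        have "real j / real n > p / 2"
          using close unfolding \<delta>_def min_less_iff_conj abs_less_iff by linarith
        then have "real j > real n * (p / 2)"
          using n by (simp add: field_simps)
        with elim have j: "j \<ge> J" "j > 0" by linarith+
        have "dist ((h j * real j powr \<alpha>) * (real j / real n) powr (- \<alpha>)) L < \<epsilon>"
          using close by (intro PQ d J j) (simp add: dist_real_def \<delta>_def)
        also have "(h j * real j powr \<alpha>) * (real j / real n) powr (- \<alpha>) = h j * real n powr \<alpha>"
          using n j by (simp add: powr_divide powr_minus field_simps)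
        finally show "\<bar>h j * real n powr \<alpha> - L\<bar> < \<epsilon>" by (simp add: dist_real_def)
      qed
    qed
    moreover have "\<delta> > 0" using d p by (simp add: \<delta>_def)
    ultimately show ?thesis by blast
  qed
  have "D \<longlonglongrightarrow> 0"
  proof (rule LIMSEQ_I)
    fix r :: real assume r: "r > 0"
    define \<epsilon> where "\<epsilon> = r / (2 * (w + 1))"
    have \<epsilon>: "\<epsilon> > 0" using r w by (simp add: \<epsilon>_def)
    from near[OF \<epsilon>] obtain \<delta> where \<delta>: "\<delta> > 0" and
      ev: "eventually (\<lambda>n. \<forall>j\<le>n. \<bar>real j / real n - p\<bar> < \<delta> \<longrightarrow> \<bar>h j * real n powr \<alpha> - L\<bar> < \<epsilon>) sequentially"
      by auto
    have ev2: "eventually (\<lambda>n. sqrt n * (real n powr \<alpha> + \<bar>L\<bar>) * (2 * exp (- 2 * n * \<delta>\<^sup>2)) < r / 2) sequentially"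
    proof -
      have "(\<lambda>n. sqrt n * (real n powr \<alpha> + \<bar>L\<bar>) * (2 * exp (- 2 * n * \<delta>\<^sup>2))) \<longlonglongrightarrow> 0"
        using \<delta> \<alpha> by real_asymp
      from order_tendstoD(2)[OF this, of "r / 2"] r show ?thesis by simp
    qed
    have ev3: "eventually (\<lambda>n. W n < w + 1) sequentially"
      by (rule order_tendstoD(2)[OF W]) simp
    have "eventually (\<lambda>n. norm (D n - 0) < r) sequentially"
      using ev ev2 ev3 eventually_gt_at_top[of 0]
    proof eventually_elim
      case (elim n)
      let ?T = "{j. j \<le> n \<and> \<bar>real j / real n - p\<bar> \<ge> \<delta>}"
      let ?K = "sqrt n * (real n powr \<alpha> + \<bar>L\<bar>)"
      have "\<bar>D n\<bar> \<le> (\<Sum>j\<le>n. \<bar>sqrt n * (bin_prob n p j)\<^sup>2 * (h j * real n powr \<alpha> - L)\<bar>)"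
        unfolding D_def by (rule sum_abs)
      also have "\<dots> \<le> (\<Sum>j\<le>n. sqrt n * (bin_prob n p j)\<^sup>2 * \<epsilon> + (if j \<in> ?T then ?K * bin_prob n p j else 0))"
      proof (rule sum_mono)
        fix j assume j: "j \<in> {..n}"
        let ?b = "bin_prob n p j"
        have eq: "\<bar>sqrt n * ?b\<^sup>2 * (h j * real n powr \<alpha> - L)\<bar> = sqrt n * ?b\<^sup>2 * \<bar>h j * real n powr \<alpha> - L\<bar>"
          by (simp add: abs_mult)
        show "\<bar>sqrt n * ?b\<^sup>2 * (h j * real n powr \<alpha> - L)\<bar> \<le> sqrt n * ?b\<^sup>2 * \<epsilon> + (if j \<in> ?T then ?K * ?b else 0)"
        proof (cases "j \<in> ?T")
          case True
          have 1: "?b\<^sup>2 \<le> ?b"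
            using bin_prob_nonneg[OF p', of n j] bin_prob_le_1[OF p', of n j]
            by (simp add: power2_eq_square mult_left_le)
          have "h j * real n powr \<alpha> \<le> 1 * real n powr \<alpha>"
            using h by (intro mult_right_mono) auto
          moreover have "0 \<le> h j * real n powr \<alpha>" using h by simp
          ultimately have 2: "\<bar>h j * real n powr \<alpha> - L\<bar> \<le> real n powr \<alpha> + \<bar>L\<bar>" by linarith
          have "sqrt n * ?b\<^sup>2 * \<bar>h j * real n powr \<alpha> - L\<bar> \<le> sqrt n * ?b * (real n powr \<alpha> + \<bar>L\<bar>)"
            using 1 2 bin_prob_nonneg[OF p', of n j] by (intro mult_mono mult_left_mono) auto
          moreover have "0 \<le> sqrt n * ?b\<^sup>2 * \<epsilon>" using \<epsilon> by simp
          ultimately show ?thesis using True unfolding eq by (simp add: mult_ac)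
        next
          case False
          then have "\<bar>h j * real n powr \<alpha> - L\<bar> \<le> \<epsilon>" using elim j by auto
          then have "sqrt n * ?b\<^sup>2 * \<bar>h j * real n powr \<alpha> - L\<bar> \<le> sqrt n * ?b\<^sup>2 * \<epsilon>"
            by (intro mult_left_mono) auto
          then show ?thesis unfolding eq if_not_P[OF False] by simp
        qed
      qed
      also have "\<dots> = \<epsilon> * W n + ?K * (\<Sum>j\<in>?T. bin_prob n p j)"
      proof -
        have "(\<Sum>j\<le>n. if j \<in> ?T then ?K * bin_prob n p j else 0) = (\<Sum>j\<in>?T. ?K * bin_prob n p j)"
          by (intro sum.mono_neutral_cong_right) auto
        then show ?thesis
          by (simp add: sum.distrib W_def sum_distrib_left sum_distrib_right mult_ac)
      qed
      also have "\<dots> \<le> \<epsilon> * W n + ?K * (2 * exp (- 2 * n * \<delta>\<^sup>2))"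
        using sum_bin_prob_tail_le[OF p', of \<delta> n] \<delta> elim by (intro add_left_mono mult_left_mono) auto
      also have "\<dots> < \<epsilon> * (w + 1) + r / 2"
        using elim \<epsilon> by (intro add_strict_mono mult_strict_left_mono) auto
      also have "\<dots> = r" using w by (simp add: \<epsilon>_def field_simps)
      finally show ?case by simp
    qed
    then show "\<exists>no. \<forall>n\<ge>no. norm (D n - 0) < r" by (simp add: eventually_at_top_linorder)
  qed
  then have "(\<lambda>n. D n + L * W n) \<longlonglongrightarrow> 0 + L * w"
    by (intro tendsto_intros W)
  moreover have "D n + L * W n = (\<Sum>j\<le>n. (bin_prob n p j)\<^sup>2 * h j) * real n powr (\<alpha> + 1 / 2)" for n
    unfolding D_def W_def sum_distrib_left sum_distrib_right sum.distrib[symmetric]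
    by (intro sum.cong refl) (simp add: powr_add powr_half_sqrt algebra_simps)
  ultimately show ?thesis by (simp add: L_def w_def)
qed

section \<open>Sums of squares of multinomial coefficients\<close>

text \<open>The sum of the squares of all multinomial coefficients of \<open>n\<close> with \<open>k\<close> parts. The recursion separates one part,
  of size \<open>n - j\<close>, from the others.\<close>

primrec sum_sq_multinom :: "nat \<Rightarrow> nat \<Rightarrow> nat" where
  "sum_sq_multinom 0 n = (if n = 0 then 1 else 0)"
| "sum_sq_multinom (Suc k) n = (\<Sum>j\<le>n. (n choose j)\<^sup>2 * sum_sq_multinom k j)"

text \<open>The sum of the squares is at most the square of the sum of all multinomial coefficients. The point
  is the bound \<open>h \<le> 1\<close> for the normalised values in the next induction.\<close>

lemma sum_sq_multinom_le: "sum_sq_multinom k n \<le> k ^ (2 * n)"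
proof (induction k arbitrary: n)
  case (Suc k)
  have "sum_sq_multinom (Suc k) n \<le> (\<Sum>j\<le>n. (n choose j)\<^sup>2 * k ^ (2 * j))"
    using Suc.IH by (auto intro!: sum_mono)
  also have "\<dots> = (\<Sum>j\<le>n. ((n choose j) * k ^ j)\<^sup>2)"
    by (simp add: power_mult_distrib power_mult mult.commute)
  also have "\<dots> \<le> (\<Sum>j\<le>n. ((n choose j) * k ^ j) * (\<Sum>i\<le>n. (n choose i) * k ^ i))"
    unfolding power2_eq_square by (intro sum_mono mult_left_mono member_le_sum) auto
  also have "\<dots> = (\<Sum>i\<le>n. (n choose i) * k ^ i)\<^sup>2"
    by (simp add: sum_distrib_right power2_eq_square)
  also have "(\<Sum>i\<le>n. (n choose i) * k ^ i) = Suc k ^ n"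
    using binomial_ring[of k 1 n] by simp
  finally show ?case by (simp add: power_mult mult.commute[of 2])
qed auto

text \<open>Adding one part weights the normalised values with the squared binomial probabilities for
  \<open>p = k / (k + 1)\<close>.\<close>

lemma sum_sq_multinom_tendsto:
  assumes "k \<ge> 1"
  shows "(\<lambda>n. real (sum_sq_multinom k n) / real k ^ (2 * n) * real n powr ((real k - 1) / 2))
           \<longlonglongrightarrow> real k powr (real k / 2) / (4 * pi) powr ((real k - 1) / 2)"
  using assms
proof (induction k rule: nat_induct_at_least)
  case base
  have "eventually (\<lambda>n. 1 = real (sum_sq_multinom 1 n) / real 1 ^ (2 * n) * real n powr ((real 1 - 1) / 2)) sequentially"
    using eventually_gt_at_top[of 0]
  proof eventually_elim
    case (elim n)
    have "sum_sq_multinom 1 n = (\<Sum>j\<le>n. if j = 0 then 1 else 0)"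
      unfolding One_nat_def sum_sq_multinom.simps by (intro sum.cong) auto
    then show ?case using elim by simp
  qed
  then show ?case by (intro Lim_transform_eventually[OF tendsto_const]) simp
next
  case (Suc k)
  define p where "p = real k / real (Suc k)"
  have p: "0 < p" "p < 1" "1 - p = 1 / real (Suc k)" using Suc.hyps by (auto simp: p_def field_simps)
  define h where "h j = real (sum_sq_multinom k j) / real k ^ (2 * j)" for j
  have h: "0 \<le> h j" "h j \<le> 1" for j
  proof -
    have "real (sum_sq_multinom k j) \<le> real (k ^ (2 * j))"
      by (intro of_nat_mono sum_sq_multinom_le)
    then show "h j \<le> 1" using Suc.hyps by (simp add: h_def divide_le_eq)
  qed (simp add: h_def)
  have "(\<lambda>n. (\<Sum>j\<le>n. (bin_prob n p j)\<^sup>2 * h j) * real n powr ((real k - 1) / 2 + 1 / 2))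
      \<longlonglongrightarrow> real k powr (real k / 2) / (4 * pi) powr ((real k - 1) / 2) * p powr (- ((real k - 1) / 2))
         / sqrt (4 * pi * p * (1 - p))"
    by (rule sum_sq_bin_prob_weighted_tendsto) (use p h Suc in \<open>auto simp: h_def\<close>)
  also have "(\<lambda>n. (\<Sum>j\<le>n. (bin_prob n p j)\<^sup>2 * h j) * real n powr ((real k - 1) / 2 + 1 / 2))
      = (\<lambda>n. real (sum_sq_multinom (Suc k) n) / real (Suc k) ^ (2 * n) * real n powr ((real (Suc k) - 1) / 2))"
  proof
    fix n
    have "(bin_prob n p j)\<^sup>2 * h j = real ((n choose j)\<^sup>2 * sum_sq_multinom k j) / real (Suc k) ^ (2 * n)"
      if "j \<le> n" for j
    proof -
      have "bin_prob n p j = real (n choose j) * real k ^ j / (real (Suc k) ^ j * real (Suc k) ^ (n - j))"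
        unfolding bin_prob_def p(3) by (simp add: p_def power_divide del: of_nat_Suc)
      also have "real (Suc k) ^ j * real (Suc k) ^ (n - j) = real (Suc k) ^ n"
        using that by (simp flip: power_add)
      finally have b: "bin_prob n p j = real (n choose j) * real k ^ j / real (Suc k) ^ n" .
      have "real k ^ (2 * j) \<noteq> 0" using Suc.hyps by simp
      then show ?thesis unfolding b h_def
        by (simp add: power_divide power_mult_distrib power_mult mult.commute[of 2] del: of_nat_Suc)
    qed
    then have "(\<Sum>j\<le>n. (bin_prob n p j)\<^sup>2 * h j) = real (sum_sq_multinom (Suc k) n) / real (Suc k) ^ (2 * n)"
      by (simp add: sum_divide_distrib)
    then show "(\<Sum>j\<le>n. (bin_prob n p j)\<^sup>2 * h j) * real n powr ((real k - 1) / 2 + 1 / 2)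
      = real (sum_sq_multinom (Suc k) n) / real (Suc k) ^ (2 * n) * real n powr ((real (Suc k) - 1) / 2)"
      by (simp add: add_divide_distrib[symmetric] del: sum_sq_multinom.simps)
  qed
  also have "real k powr (real k / 2) / (4 * pi) powr ((real k - 1) / 2) * p powr (- ((real k - 1) / 2))
         / sqrt (4 * pi * p * (1 - p))
      = real (Suc k) powr (real (Suc k) / 2) / (4 * pi) powr ((real (Suc k) - 1) / 2)"
  proof -
    define x y where "x = real k" and "y = real (Suc k)"
    have xy: "x > 0" "y > 0" "y = x + 1" using Suc.hyps by (auto simp: x_def y_def)
    have "sqrt (4 * pi * p * (1 - p)) = ((4 * pi) * x / (y * y)) powr (1 / 2)"
      using xy by (simp add: p(3) powr_half_sqrt) (simp add: p_def x_def y_def field_simps)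
    also have "\<dots> = (4 * pi) powr (1 / 2) * x powr (1 / 2) / y"
      using xy by (simp add: powr_mult powr_divide powr_half_sqrt)
    finally have 1: "sqrt (4 * pi * p * (1 - p)) = (4 * pi) powr (1 / 2) * x powr (1 / 2) / y" .
    have "p = x / y" by (simp only: p_def x_def y_def)
    then have 2: "p powr (- ((x - 1) / 2)) = y powr ((x - 1) / 2) / x powr ((x - 1) / 2)"
      using xy(1,2) by (simp add: powr_minus powr_divide)
    have 3: "x powr (x / 2) = x powr ((x - 1) / 2) * x powr (1 / 2)"
      using xy by (simp flip: powr_add add: field_simps)
    have 4: "y powr (y / 2) = y powr ((x - 1) / 2) * y"
    proof -
      have "y / 2 = (x - 1) / 2 + 1" using xy by (simp add: field_simps)
      then show ?thesis using xy by (simp only: powr_add powr_one)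
    qed
    have 5: "(4 * pi) powr ((y - 1) / 2) = (4 * pi) powr ((x - 1) / 2) * (4 * pi) powr (1 / 2)"
      using xy by (simp flip: powr_add add: field_simps)
    show ?thesis unfolding x_def[symmetric] y_def[symmetric] 1 2 3 4 5
      using xy by (simp add: field_simps)
  qed
  finally show ?case .
qed


section \<open>Balanced digraphs\<close>

text \<open>Pairs of words in which each letter occurs equally often. The words have separate index sets because the
  removal of one letter leaves different sets of positions in the two words.\<close>

definition equidistributed_pairs :: "'i set \<Rightarrow> 'j set \<Rightarrow> 'v set \<Rightarrow> (('i \<Rightarrow> 'v) \<times> ('j \<Rightarrow> 'v)) set" where
  "equidistributed_pairs I J V = {(s, t). s \<in> I \<rightarrow>\<^sub>E V \<and> t \<in> J \<rightarrow>\<^sub>E V \<and>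
     (\<forall>x\<in>V. card {i \<in> I. s i = x} = card {j \<in> J. t j = x})}"

lemma finite_equidistributed_pairs:
  "finite I \<Longrightarrow> finite J \<Longrightarrow> finite V \<Longrightarrow> finite (equidistributed_pairs I J V)"
  by (rule finite_subset[of _ "(I \<rightarrow>\<^sub>E V) \<times> (J \<rightarrow>\<^sub>E V)"])
     (auto simp: equidistributed_pairs_def finite_PiE)

text \<open>Induction on the alphabet: a pair over \<open>insert w V\<close> is determined by the positions not occupied
  by \<open>w\<close>, which are \<open>j\<close> in each of the two words, and by a pair over \<open>V\<close> on these positions.\<close>

lemma card_equidistributed_pairs:
  fixes V :: "'v set"
  assumes "finite V" "finite I" "finite J" "card I = n" "card J = n"
  shows "card (equidistributed_pairs I J V) = sum_sq_multinom (card V) n"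
  using assms
proof (induction V arbitrary: I J n rule: finite_induct)
  case empty
  show ?case
  proof (cases "n = 0")
    case True
    then have "I = {}" "J = {}" using empty by auto
    then have "equidistributed_pairs I J ({} :: 'v set) = {(\<lambda>_. undefined, \<lambda>_. undefined)}"
      by (auto simp: equidistributed_pairs_def)
    then show ?thesis using True by simp
  next
    case False
    then have "I \<noteq> {}" using empty by auto
    then have "equidistributed_pairs I J ({} :: 'v set) = {}"
      by (auto simp: equidistributed_pairs_def PiE_eq_empty_iff)
    then show ?thesis using False by simp
  qed
next
  case (insert w V)
  let ?P = "\<lambda>I j. {A. A \<subseteq> I \<and> card A = j}"
  let ?T = "SIGMA j:{..n}. SIGMA (A, B):?P I j \<times> ?P J j. equidistributed_pairs A B V"
  let ?f = "\<lambda>(s, t). (card {i \<in> I. s i \<noteq> w}, ({i \<in> I. s i \<noteq> w}, {j \<in> J. t j \<noteq> w}),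
     (restrict s {i \<in> I. s i \<noteq> w}, restrict t {j \<in> J. t j \<noteq> w}))"
  let ?g = "\<lambda>(j :: nat, (A, B), (s, t)). (\<lambda>i\<in>I. if i \<in> A then s i else w, \<lambda>i\<in>J. if i \<in> B then t i else w)"
  have card_split: "card {i \<in> I. s i \<noteq> w} = card I - card {i \<in> I. s i = w}" if "finite I"
    for I :: "'x set" and s :: "'x \<Rightarrow> 'v"
  proof -
    have "{i \<in> I. s i \<noteq> w} = I - {i \<in> I. s i = w}" by auto
    then show ?thesis using that by (simp add: card_Diff_subset)
  qed
  have fib: "{i \<in> I. s i \<noteq> w \<and> s i = x} = {i \<in> I. s i = x}"
    if "x \<in> V" for I :: "'x set" and s :: "'x \<Rightarrow> 'v" and x
    using that insert.hyps by auto
  have "bij_betw ?f (equidistributed_pairs I J (insert w V)) ?T"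
  proof (rule bij_betw_byWitness[where f' = ?g])
    show "\<forall>a\<in>equidistributed_pairs I J (insert w V). ?g (?f a) = a"
      by (auto simp: equidistributed_pairs_def fun_eq_iff PiE_iff extensional_def)
    show "\<forall>b\<in>?T. ?f (?g b) = b"
    proof (rule ballI)
      fix b assume "b \<in> ?T"
      then obtain A B s t where b: "b = (card A, (A, B), (s, t))" and
        *: "A \<subseteq> I" "B \<subseteq> J" "card B = card A" "(s, t) \<in> equidistributed_pairs A B V"
        by auto
      then have "s i \<in> V" if "i \<in> A" for i using that by (auto simp: equidistributed_pairs_def)
      moreover have "t i \<in> V" if "i \<in> B" for i using * that by (auto simp: equidistributed_pairs_def)
      ultimately have "s i \<noteq> w" if "i \<in> A" for i using that insert.hyps by auto
      moreover have "t i \<noteq> w" if "i \<in> B" for i using that insert.hyps \<open>\<And>i. i \<in> B \<Longrightarrow> t i \<in> V\<close> by auto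
      ultimately have "{i \<in> I. (\<lambda>i\<in>I. if i \<in> A then s i else w) i \<noteq> w} = A"
        "{i \<in> J. (\<lambda>i\<in>J. if i \<in> B then t i else w) i \<noteq> w} = B"
        using * by auto
      moreover have "restrict (\<lambda>i\<in>I. if i \<in> A then s i else w) A = s"
        "restrict (\<lambda>i\<in>J. if i \<in> B then t i else w) B = t"
        using * by (auto simp: equidistributed_pairs_def fun_eq_iff PiE_iff extensional_def)
      ultimately show "?f (?g b) = b"
        unfolding b by (simp only: prod.case)
    qed
    show "?f ` equidistributed_pairs I J (insert w V) \<subseteq> ?T"
    proof (rule image_subsetI)
      fix a assume "a \<in> equidistributed_pairs I J (insert w V)"
      then obtain s t where a: "a = (s, t)" and st: "(s, t) \<in> equidistributed_pairs I J (insert w V)"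
        by (cases a) auto
      let ?A = "{i \<in> I. s i \<noteq> w}" and ?B = "{i \<in> J. t i \<noteq> w}"
      from st have "card ?A = card ?B"
        using insert.prems by (simp add: card_split equidistributed_pairs_def)
      moreover have "card ?A \<le> n"
        using insert.prems by (auto intro: card_mono)
      moreover have "(restrict s ?A, restrict t ?B) \<in> equidistributed_pairs ?A ?B V"
        using st by (auto simp: equidistributed_pairs_def fib restrict_def cong: conj_cong)
      ultimately show "?f a \<in> ?T" unfolding a by auto
    qed
    show "?g ` ?T \<subseteq> equidistributed_pairs I J (insert w V)"
    proof (rule image_subsetI)
      fix b assume "b \<in> ?T"
      then obtain A B s t where b: "b = (card A, (A, B), (s, t))" and
        *: "A \<subseteq> I" "B \<subseteq> J" "card B = card A" "(s, t) \<in> equidistributed_pairs A B V"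
        by auto
      have sV: "s i \<in> V" if "i \<in> A" for i using * that by (auto simp: equidistributed_pairs_def)
      have tV: "t i \<in> V" if "i \<in> B" for i using * that by (auto simp: equidistributed_pairs_def)
      let ?s = "\<lambda>i\<in>I. if i \<in> A then s i else w" and ?t = "\<lambda>i\<in>J. if i \<in> B then t i else w"
      have "card {i \<in> I. ?s i = x} = card {j \<in> J. ?t j = x}" if "x \<in> insert w V" for x
      proof (cases "x = w")
        case True
        have "{i \<in> I. ?s i = x} = I - A" "{i \<in> J. ?t i = x} = J - B"
          using * True sV tV insert.hyps by auto
        then show ?thesis using * insert.prems by (simp add: card_Diff_subset finite_subset)
      next
        case False
        then have "{i \<in> I. ?s i = x} = {i \<in> A. s i = x}" "{i \<in> J. ?t i = x} = {i \<in> B. t i = x}"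
          using * by auto
        then show ?thesis using * that False by (auto simp: equidistributed_pairs_def)
      qed
      then show "?g b \<in> equidistributed_pairs I J (insert w V)"
        unfolding b using sV tV by (auto simp: equidistributed_pairs_def)
    qed
  qed
  then have "card (equidistributed_pairs I J (insert w V)) = card ?T"
    by (rule bij_betw_same_card)
  also have "\<dots> = (\<Sum>j\<le>n. \<Sum>(A, B)\<in>?P I j \<times> ?P J j. card (equidistributed_pairs A B V))"
  proof -
    have fin: "finite (?P I j)" "finite (?P J j)" for j using insert.prems by auto
    have fin2: "finite (equidistributed_pairs A B V)" if "A \<subseteq> I" "B \<subseteq> J" for A B
      using that insert.prems insert.hyps by (intro finite_equidistributed_pairs) (auto intro: finite_subset)
    have "card (SIGMA (A, B):?P I j \<times> ?P J j. equidistributed_pairs A B V)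
        = (\<Sum>(A, B)\<in>?P I j \<times> ?P J j. card (equidistributed_pairs A B V))" for j
      by (subst card_SigmaI) (use fin fin2 in \<open>auto simp: case_prod_beta\<close>)
    moreover have "finite (SIGMA (A, B):?P I j \<times> ?P J j. equidistributed_pairs A B V)" for j
      by (intro finite_SigmaI) (use fin fin2 in auto)
    ultimately show ?thesis by (subst card_SigmaI) auto
  qed
  also have "\<dots> = (\<Sum>j\<le>n. \<Sum>(A, B)\<in>?P I j \<times> ?P J j. sum_sq_multinom (card V) j)"
    using insert.prems by (intro sum.cong refl) (auto intro!: insert.IH intro: finite_subset)
  also have "\<dots> = (\<Sum>j\<le>n. (n choose j)\<^sup>2 * sum_sq_multinom (card V) j)"
    using insert.prems by (simp add: case_prod_beta card_cartesian_product n_subsets power2_eq_square)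
  finally show ?case using insert.hyps by simp
qed

text \<open>A map \<open>f : I \<rightarrow> V \<times> V\<close> encodes a directed multigraph with loops on \<open>V\<close> whose arcs are labelled by \<open>I\<close>: arc \<open>i\<close> leads
  from \<open>fst (f i)\<close> to \<open>snd (f i)\<close>.\<close>

definition balanced_digraphs :: "'i set \<Rightarrow> 'v set \<Rightarrow> ('i \<Rightarrow> 'v \<times> 'v) set" where
  "balanced_digraphs I V = {f \<in> I \<rightarrow>\<^sub>E V \<times> V.
     \<forall>x\<in>V. card {i \<in> I. fst (f i) = x} = card {i \<in> I. snd (f i) = x}}"

lemma finite_balanced_digraphs: "finite I \<Longrightarrow> finite V \<Longrightarrow> finite (balanced_digraphs I V)"
  by (rule finite_subset[of _ "I \<rightarrow>\<^sub>E V \<times> V"]) (auto simp: balanced_digraphs_def finite_PiE)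

lemma card_balanced_digraphs:
  assumes "finite I" "finite V"
  shows "card (balanced_digraphs I V) = sum_sq_multinom (card V) (card I)"
proof -
  let ?f = "\<lambda>f. (\<lambda>i\<in>I. fst (f i), \<lambda>i\<in>I. snd (f i))"
  let ?g = "\<lambda>(s, t). \<lambda>i\<in>I. (s i, t i)"
  have "bij_betw ?f (balanced_digraphs I V) (equidistributed_pairs I I V)"
  proof (rule bij_betw_byWitness[where f' = ?g])
    show "\<forall>f\<in>balanced_digraphs I V. ?g (?f f) = f"
      by (auto simp: balanced_digraphs_def fun_eq_iff PiE_iff extensional_def)
    show "\<forall>p\<in>equidistributed_pairs I I V. ?f (?g p) = p"
      by (auto simp: equidistributed_pairs_def fun_eq_iff PiE_iff extensional_def)
    show "?f ` balanced_digraphs I V \<subseteq> equidistributed_pairs I I V"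
      by (auto simp: balanced_digraphs_def equidistributed_pairs_def PiE_iff mem_Times_iff cong: conj_cong)
    show "?g ` equidistributed_pairs I I V \<subseteq> balanced_digraphs I V"
      by (auto simp: balanced_digraphs_def equidistributed_pairs_def cong: conj_cong)
  qed
  then show ?thesis
    using assms by (simp add: bij_betw_same_card card_equidistributed_pairs)
qed

text \<open>Exchanging two vertices preserves balance, so each vertex is equally often the head of the
  arc \<open>i\<close>.\<close>

lemma card_balanced_digraphs_head:
  assumes "finite I" "finite V" "i \<in> I" "v \<in> V"
  shows "card V * card {f \<in> balanced_digraphs I V. snd (f i) = v} = card (balanced_digraphs I V)"
proof -
  let ?Z = "\<lambda>v. {f \<in> balanced_digraphs I V. snd (f i) = v}"
  have le: "card (?Z u) \<le> card (?Z w)" if uw: "u \<in> V" "w \<in> V" for u w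
  proof (rule card_inj_on_le)
    let ?\<tau> = "Transposition.transpose u w"
    let ?r = "\<lambda>f. \<lambda>j\<in>I. map_prod ?\<tau> ?\<tau> (f j)"
    have inV: "?\<tau> x \<in> V" if "x \<in> V" for x
      using uw that by (auto simp: Transposition.transpose_def)
    show "inj_on ?r (?Z u)"
    proof (rule inj_onI)
      fix f g assume fg: "f \<in> ?Z u" "g \<in> ?Z u" "?r f = ?r g"
      have "f j = g j" if "j \<in> I" for j
        using fun_cong[OF fg(3), of j] that by (auto simp: prod_eq_iff dest: injD[OF inj_transpose])
      then show "f = g"
        using fg by (auto simp: balanced_digraphs_def intro: PiE_ext)
    qed
    show "?r ` ?Z u \<subseteq> ?Z w"
    proof (rule image_subsetI)
      fix f assume "f \<in> ?Z u"
      then have f: "f \<in> I \<rightarrow>\<^sub>E V \<times> V" "snd (f i) = u"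
        and bal: "\<And>x. x \<in> V \<Longrightarrow> card {j \<in> I. fst (f j) = x} = card {j \<in> I. snd (f j) = x}"
        by (auto simp: balanced_digraphs_def)
      have "{j \<in> I. fst (?r f j) = x} = {j \<in> I. fst (f j) = ?\<tau> x}"
        "{j \<in> I. snd (?r f j) = x} = {j \<in> I. snd (f j) = ?\<tau> x}" for x
        by (auto simp: Transposition.transpose_def)
      then have "\<forall>x\<in>V. card {j \<in> I. fst (?r f j) = x} = card {j \<in> I. snd (?r f j) = x}"
        using bal inV by simp
      moreover have "?r f \<in> I \<rightarrow>\<^sub>E V \<times> V"
        using f(1) inV by (auto simp: PiE_iff mem_Times_iff)
      ultimately show "?r f \<in> ?Z w"
        using f(2) assms by (simp add: balanced_digraphs_def)
    qed
  qed (use assms finite_balanced_digraphs[of I V] in auto)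
  have "card (?Z u) = card (?Z v)" if "u \<in> V" for u
    using le that assms by (simp add: le_antisym)
  then have "(\<Sum>u\<in>V. card (?Z u)) = card V * card (?Z v)" by simp
  moreover have "(\<Sum>u\<in>V. card (?Z u)) = card (\<Union>u\<in>V. ?Z u)"
    using assms finite_balanced_digraphs[of I V] by (intro card_UN_disjoint[symmetric]) auto
  moreover have "(\<Union>u\<in>V. ?Z u) = balanced_digraphs I V"
    using assms by (auto simp: balanced_digraphs_def mem_Times_iff PiE_iff)
  ultimately show ?thesis by simp
qed


section \<open>Digraphs with an Eulerian trail\<close>

fun is_trail :: "('i \<Rightarrow> 'v \<times> 'v) \<Rightarrow> 'v \<Rightarrow> 'i list \<Rightarrow> bool" where
  "is_trail f v [] = True"
| "is_trail f v (i # p) = (fst (f i) = v \<and> is_trail f (snd (f i)) p)"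

fun trail_end :: "('i \<Rightarrow> 'v \<times> 'v) \<Rightarrow> 'v \<Rightarrow> 'i list \<Rightarrow> 'v" where
  "trail_end f v [] = v"
| "trail_end f v (i # p) = trail_end f (snd (f i)) p"

text \<open>The trail has to use every arc, but it need not visit every vertex.\<close>

definition eulerian_digraphs :: "'i set \<Rightarrow> 'v set \<Rightarrow> 'v \<Rightarrow> ('i \<Rightarrow> 'v \<times> 'v) set" where
  "eulerian_digraphs I V v = {f \<in> I \<rightarrow>\<^sub>E V \<times> V. \<exists>p. distinct p \<and> set p = I \<and> is_trail f v p}"

lemma finite_eulerian_digraphs: "finite I \<Longrightarrow> finite V \<Longrightarrow> finite (eulerian_digraphs I V v)"
  by (rule finite_subset[of _ "I \<rightarrow>\<^sub>E V \<times> V"]) (auto simp: eulerian_digraphs_def finite_PiE)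

lemma is_trail_cong: "(\<And>i. i \<in> set p \<Longrightarrow> f i = g i) \<Longrightarrow> is_trail f v p = is_trail g v p"
  by (induction p arbitrary: v) auto

lemma card_filter_insert:
  "finite A \<Longrightarrow> a \<notin> A \<Longrightarrow> card {i \<in> insert a A. P i} = of_bool (P a) + card {i \<in> A. P i}"
proof -
  assume "finite A" "a \<notin> A"
  moreover have "{i \<in> insert a A. P i} = (if P a then insert a {i \<in> A. P i} else {i \<in> A. P i})" by auto
  ultimately show ?thesis by simp
qed

text \<open>Each arc of a trail but the last is followed by an arc that leaves its head.\<close>

lemma is_trail_degrees:
  assumes "is_trail f v p" "distinct p"
  shows "card {i \<in> set p. fst (f i) = x} + of_bool (x = trail_end f v p)
       = card {i \<in> set p. snd (f i) = x} + of_bool (x = v)"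
  using assms
proof (induction p arbitrary: v)
  case (Cons a p)
  then have "card {i \<in> set p. fst (f i) = x} + of_bool (x = trail_end f v (a # p))
      = card {i \<in> set p. snd (f i) = x} + of_bool (snd (f a) = x)"
    by (simp add: eq_commute[of x "snd (f a)"])
  moreover have "of_bool (x = v) = (of_bool (fst (f a) = x) :: nat)"
    using Cons.prems by auto
  moreover have "card {i \<in> set (a # p). P i} = of_bool (P a) + card {i \<in> set p. P i}" for P
    unfolding list.set using Cons.prems by (intro card_filter_insert) auto
  ultimately show ?case by simp
qed simp

lemma trail_end_cong: "(\<And>i. i \<in> set p \<Longrightarrow> f i = g i) \<Longrightarrow> trail_end f v p = trail_end g v p"
  by (induction p arbitrary: v) auto

text \<open>The degrees of the vertices determine the end of an Eulerian trail once its start is known.\<close>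

lemma trail_end_unique:
  assumes "is_trail f v p" "is_trail f v q" "distinct p" "distinct q" "set p = set q"
  shows "trail_end f v p = trail_end f v q"
  using is_trail_degrees[OF assms(1,3), of "trail_end f v p"]
    is_trail_degrees[OF assms(2,4), of "trail_end f v p"] assms(5)
  by (cases "trail_end f v p = trail_end f v q") auto

lemma trail_end_in:
  assumes "f \<in> I \<rightarrow>\<^sub>E V \<times> V" "set p \<subseteq> I" "v \<in> V"
  shows "trail_end f v p \<in> V"
  using assms
proof (induction p arbitrary: v)
  case (Cons a p)
  then have "f a \<in> V \<times> V" by auto
  then show ?case using Cons by (auto simp: mem_Times_iff)
qed simp

text \<open>Closing an Eulerian trail by a new arc \<open>i0\<close> from its end to its start \<open>v\<close> gives a balanced digraph.\<close>

lemma eulerian_digraphs_subset: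
  assumes "i0 \<notin> I" "finite I" "v \<in> V"
  shows "eulerian_digraphs I V v
     \<subseteq> (\<lambda>f. restrict f I) ` {f \<in> balanced_digraphs (insert i0 I) V. snd (f i0) = v}"
proof
  fix f assume f: "f \<in> eulerian_digraphs I V v"
  then obtain p where p: "distinct p" "set p = I" "is_trail f v p" and fI: "f \<in> I \<rightarrow>\<^sub>E V \<times> V"
    by (auto simp: eulerian_digraphs_def)
  define g where "g = f(i0 := (trail_end f v p, v))"
  have gI: "g j = f j" if "j \<in> I" for j using that assms by (auto simp: g_def)
  have "g \<in> insert i0 I \<rightarrow>\<^sub>E V \<times> V"
    unfolding g_def using fI assms trail_end_in[OF fI, of p v] p
    by (auto simp: PiE_iff extensional_def)
  moreover have "card {i \<in> insert i0 I. fst (g i) = x} = card {i \<in> insert i0 I. snd (g i) = x}" for x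
  proof -
    have "{i \<in> I. fst (g i) = x} = {i \<in> I. fst (f i) = x}" "{i \<in> I. snd (g i) = x} = {i \<in> I. snd (f i) = x}"
      using gI by auto
    then show ?thesis
      using is_trail_degrees[OF p(3,1), of x] assms p(2)
      by (simp add: card_filter_insert g_def eq_commute[of x] del: insert_iff)
  qed
  moreover have "restrict g I = f"
    using fI gI by (auto simp: fun_eq_iff PiE_iff extensional_def)
  moreover have "snd (g i0) = v" by (simp add: g_def)
  ultimately show "f \<in> (\<lambda>f. restrict f I) ` {f \<in> balanced_digraphs (insert i0 I) V. snd (f i0) = v}"
    by (intro image_eqI[of _ _ g]) (auto simp: balanced_digraphs_def)
qed

text \<open>In a balanced digraph the other arcs determine the tail of an arc whose head is known.\<close>

lemma inj_on_restrict_balanced: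
  assumes "i0 \<notin> I" "finite I"
  shows "inj_on (\<lambda>f. restrict f I) {f \<in> balanced_digraphs (insert i0 I) V. snd (f i0) = v}"
proof (rule inj_onI, clarify)
  fix f g assume f: "f \<in> balanced_digraphs (insert i0 I) V" and g: "g \<in> balanced_digraphs (insert i0 I) V"
    and eq: "restrict f I = restrict g I" and v: "snd (g i0) = snd (f i0)"
  have fg: "f j = g j" if "j \<in> I" for j using fun_cong[OF eq, of j] that by simp
  let ?x = "fst (f i0)"
  have x: "?x \<in> V" using f by (auto simp: balanced_digraphs_def PiE_iff mem_Times_iff)
  have "card {i \<in> insert i0 I. fst (f i) = ?x} = card {i \<in> insert i0 I. snd (f i) = ?x}"
    "card {i \<in> insert i0 I. fst (g i) = ?x} = card {i \<in> insert i0 I. snd (g i) = ?x}"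
    using f g x by (auto simp: balanced_digraphs_def)
  moreover have "{i \<in> I. fst (f i) = ?x} = {i \<in> I. fst (g i) = ?x}" "{i \<in> I. snd (f i) = ?x} = {i \<in> I. snd (g i) = ?x}"
    using fg by auto
  ultimately have "of_bool (fst (g i0) = ?x) = (1 :: nat)"
    using assms v by (simp add: card_filter_insert del: insert_iff)
  then have "fst (g i0) = ?x" by (cases "fst (g i0) = ?x") auto
  then have "f i0 = g i0" using v by (simp add: prod_eq_iff)
  then show "f = g"
    using f g fg by (intro PiE_ext[of f "insert i0 I" "\<lambda>_. V \<times> V" g]) (auto simp: balanced_digraphs_def)
qed

text \<open>If every pair of vertices occurs as an arc, the digraph is connected. A closed Eulerian trail can then
  be rotated so that \<open>i0\<close> comes last, and without \<open>i0\<close> it is an Eulerian trail from the head of \<open>i0\<close>.\<close>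

lemma balanced_surj_imp_eulerian:
  assumes "finite I" "finite V" "i0 \<notin> I"
    and f: "f \<in> balanced_digraphs (insert i0 I) V" and surj: "f ` insert i0 I = V \<times> V"
  shows "restrict f I \<in> eulerian_digraphs I V (snd (f i0))"
proof -
  define D where "D = \<lparr>verts = V, arcs = insert i0 I, tail = fst \<circ> f, head = snd \<circ> f\<rparr>"
  have inV: "fst (f i) \<in> V" "snd (f i) \<in> V" if "i \<in> insert i0 I" for i
    using f that by (auto simp: balanced_digraphs_def PiE_iff mem_Times_iff)
  interpret D: fin_digraph D
    by unfold_locales (use inV assms in \<open>auto simp: D_def\<close>)
  have reach: "reachable D u w" if "u \<in> V" "w \<in> V" for u w
  proof -
    have "(u, w) \<in> f ` insert i0 I" using that surj by simp
    then obtain i where "(u, w) = f i" "i \<in> insert i0 I" by (rule imageE)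
    then have "(u, w) \<in> arcs_ends D" unfolding arcs_ends_def arc_to_ends_def D_def
      by (intro image_eqI[of _ _ i]) auto
    then show ?thesis by (rule D.reachable_adjI)
  qed
  have con: "Digraph_Component.connected D"
    unfolding Digraph_Component.connected_def
  proof (rule strongly_connectedI)
    show "verts (with_proj (mk_symmetric D)) \<noteq> {}" using inV by (auto simp: D_def)
    fix u w assume "u \<in> verts (with_proj (mk_symmetric D))" "w \<in> verts (with_proj (mk_symmetric D))"
    then have "u \<in> V" "w \<in> V" by (simp_all add: D_def)
    then show "u \<rightarrow>\<^sup>*\<^bsub>with_proj (mk_symmetric D)\<^esub> w"
      by (intro D.reachable_mk_symmetricI reach)
  qed
  have "in_degree D u = out_degree D u" if "u \<in> verts D" for u
    using f that by (auto simp: balanced_digraphs_def in_degree_def out_degree_def in_arcs_def out_arcs_def D_def)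
  from D.closed_euler1[OF con this] obtain u q where q: "D.euler_trail u q u" by auto
  have D_simps: "arcs D = insert i0 I" "tail D i = fst (f i)" "head D i = snd (f i)" for i
    by (simp_all add: D_def)
  from q have qs: "distinct q" "set q = insert i0 I" "D.cas u q u"
    by (simp_all add: D.euler_trail_def D.trail_def D.awalk_def D_simps)
  have "i0 \<in> set q" using qs by simp
  then obtain q1 q2 where split: "q = q1 @ i0 # q2" by (meson split_list)
  have is_trail: "is_trail f u p" if "D.cas u p w" for u p w
    using that by (induction p arbitrary: u) (auto simp: D_simps)
  have cas_append: "D.cas u (p @ r) w \<longleftrightarrow> (\<exists>x. D.cas u p x \<and> D.cas x r w)" for u p r w
    by (induction p arbitrary: u) auto
  from qs(3) have "D.cas (snd (f i0)) (q2 @ q1) (fst (f i0))"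
    unfolding split cas_append D.cas.simps D_simps by (blast intro: refl)
  then have "is_trail f (snd (f i0)) (q2 @ q1)" by (rule is_trail)
  moreover have dist: "distinct (q2 @ q1)" "set (q2 @ q1) = I"
    using qs assms(3) unfolding split by auto
  ultimately have "is_trail (restrict f I) (snd (f i0)) (q2 @ q1)"
    by (subst is_trail_cong[of _ _ f]) auto
  moreover have "restrict f I \<in> I \<rightarrow>\<^sub>E V \<times> V"
    using inV by (auto simp: PiE_iff mem_Times_iff)
  ultimately show ?thesis using dist unfolding eulerian_digraphs_def by blast
qed

lemma card_non_surj_le:
  assumes "finite I" "finite E"
  shows "card {f \<in> I \<rightarrow>\<^sub>E E. f ` I \<noteq> E} \<le> card E * (card E - 1) ^ card I"
proof -
  have "{f \<in> I \<rightarrow>\<^sub>E E. f ` I \<noteq> E} \<subseteq> (\<Union>e\<in>E. I \<rightarrow>\<^sub>E (E - {e}))"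
    by (fastforce simp: PiE_iff)
  then have "card {f \<in> I \<rightarrow>\<^sub>E E. f ` I \<noteq> E} \<le> card (\<Union>e\<in>E. I \<rightarrow>\<^sub>E (E - {e}))"
    using assms by (intro card_mono) (auto intro!: finite_PiE)
  also have "\<dots> \<le> (\<Sum>e\<in>E. card (I \<rightarrow>\<^sub>E (E - {e})))"
    by (intro card_UN_le assms)
  also have "\<dots> = card E * (card E - 1) ^ card I"
    using assms by (simp add: card_funcsetE)
  finally show ?thesis .
qed

lemma card_balanced_head_le:
  assumes "finite I" "finite V" "i0 \<notin> I"
  shows "card {f \<in> balanced_digraphs (insert i0 I) V. snd (f i0) = v}
      \<le> card (eulerian_digraphs I V v) + (card V)\<^sup>2 * ((card V)\<^sup>2 - 1) ^ Suc (card I)"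
proof -
  let ?J = "insert i0 I"
  let ?Z = "{f \<in> balanced_digraphs ?J V. snd (f i0) = v}"
  let ?S = "{f \<in> ?Z. f ` ?J = V \<times> V}" and ?N = "{f \<in> ?J \<rightarrow>\<^sub>E V \<times> V. f ` ?J \<noteq> V \<times> V}"
  have "finite ?Z" using assms finite_balanced_digraphs[of ?J V] by auto
  moreover have "finite ?N"
    by (rule finite_subset[of _ "?J \<rightarrow>\<^sub>E V \<times> V"]) (use assms in \<open>auto intro!: finite_PiE\<close>)
  ultimately have fin: "finite ?Z" "finite ?N" .
  have "?Z \<subseteq> ?S \<union> ?N" by (auto simp: balanced_digraphs_def)
  moreover have "finite ?S" by (rule finite_subset[OF _ fin(1)]) auto
  ultimately have "card ?Z \<le> card (?S \<union> ?N)" using fin by (intro card_mono) auto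
  also have "\<dots> \<le> card ?S + card ?N" by (rule card_Un_le)
  also have "card ?S \<le> card (eulerian_digraphs I V v)"
  proof (rule card_inj_on_le)
    show "inj_on (\<lambda>f. restrict f I) ?S"
      by (rule inj_on_subset[OF inj_on_restrict_balanced[OF assms(3,1), where v = v]]) auto
    show "(\<lambda>f. restrict f I) ` ?S \<subseteq> eulerian_digraphs I V v"
      using balanced_surj_imp_eulerian[OF assms] by blast
  qed (rule finite_eulerian_digraphs[OF assms(1,2)])
  also have "card ?N \<le> (card V)\<^sup>2 * ((card V)\<^sup>2 - 1) ^ Suc (card I)"
    using card_non_surj_le[of ?J "V \<times> V"] assms by (simp add: card_cartesian_product power2_eq_square)
  finally show ?thesis by simp
qed

text \<open>The sum counts all balanced digraphs with one arc more, and \<open>1 / card V\<close> of them have the head of the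
  new arc at \<open>v\<close>. The error term bounds the number of those in which some pair of vertices is not an arc.\<close>

lemma card_eulerian_digraphs_bounds:
  assumes "finite I" "finite V" "v \<in> V" "i0 \<notin> I"
  shows "card V * card (eulerian_digraphs I V v) \<le> sum_sq_multinom (card V) (Suc (card I))"
    and "sum_sq_multinom (card V) (Suc (card I))
      \<le> card V * (card (eulerian_digraphs I V v) + (card V)\<^sup>2 * ((card V)\<^sup>2 - 1) ^ Suc (card I))"
proof -
  let ?Z = "{f \<in> balanced_digraphs (insert i0 I) V. snd (f i0) = v}"
  have eq: "sum_sq_multinom (card V) (Suc (card I)) = card V * card ?Z"
    using assms by (simp add: card_balanced_digraphs_head card_balanced_digraphs)
  have "card (eulerian_digraphs I V v) \<le> card ?Z"
    using assms finite_balanced_digraphs[of "insert i0 I" V]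
    by (intro surj_card_le[OF _ eulerian_digraphs_subset]) auto
  then show "card V * card (eulerian_digraphs I V v) \<le> sum_sq_multinom (card V) (Suc (card I))"
    unfolding eq by (rule mult_le_mono2)
  show "sum_sq_multinom (card V) (Suc (card I))
      \<le> card V * (card (eulerian_digraphs I V v) + (card V)\<^sup>2 * ((card V)\<^sup>2 - 1) ^ Suc (card I))"
    unfolding eq by (intro mult_le_mono2 card_balanced_head_le assms)
qed


section \<open>The dimension of a quotient\<close>

text \<open>Coordinate functionals \<open>L r\<close> with common kernel \<open>N\<close> and dual vectors \<open>b r\<close>: the cosets of the \<open>b r\<close>
  form a basis of the quotient, because \<open>L r v\<close> is the only possible coefficient of \<open>b r\<close> in the coset of \<open>v\<close>.\<close>

lemma quotient_module_dim:
  assumes vs: "vectorspace K V" and sub: "submodule K N V" and "finite R"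
    and b: "\<And>r. r \<in> R \<Longrightarrow> b r \<in> carrier V"
    and L: "\<And>r v. r \<in> R \<Longrightarrow> v \<in> carrier V \<Longrightarrow> L r v \<in> carrier K"
    and L_add: "\<And>r u v. r \<in> R \<Longrightarrow> u \<in> carrier V \<Longrightarrow> v \<in> carrier V \<Longrightarrow> L r (u \<oplus>\<^bsub>V\<^esub> v) = L r u \<oplus>\<^bsub>K\<^esub> L r v"
    and L_smult: "\<And>r c v. r \<in> R \<Longrightarrow> c \<in> carrier K \<Longrightarrow> v \<in> carrier V \<Longrightarrow> L r (c \<odot>\<^bsub>V\<^esub> v) = c \<otimes>\<^bsub>K\<^esub> L r v"
    and L_b: "\<And>r s. r \<in> R \<Longrightarrow> s \<in> R \<Longrightarrow> L r (b s) = (if r = s then \<one>\<^bsub>K\<^esub> else \<zero>\<^bsub>K\<^esub>)"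
    and N: "\<And>v. v \<in> carrier V \<Longrightarrow> v \<in> N \<longleftrightarrow> (\<forall>r\<in>R. L r v = \<zero>\<^bsub>K\<^esub>)"
  shows "vectorspace.dim K (quotient_module V N) = card R"
proof -
  interpret V: vectorspace K V by fact
  interpret N: submodule K N V by fact
  let ?Q = "quotient_module V N"
  interpret Q: vectorspace K ?Q by (rule quotient_module_vectorspace[OF vs sub])
  have "subgroup N (add_monoid V)"
  proof (rule V.M.add.subgroupI)
    show "N \<noteq> {}"
      using N.zero_closed by blast
    show "\<ominus>\<^bsub>V\<^esub> x \<in> N" if "x \<in> N" for x
      using that N.smult_closed[of "\<ominus>\<^bsub>K\<^esub> \<one>\<^bsub>K\<^esub>" x] N.subset
      by (metis V.R.add.inv_closed V.R.one_closed V.smult_minus_1 subsetD)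
  qed (use N.subset N.m_closed in simp_all)
  then interpret A: abelian_subgroup N V
    by (intro abelian_subgroupI3 additive_subgroup.intro) (auto intro: V.M.abelian_group_axioms)
  define q where "q x = N +>\<^bsub>V\<^esub> x" for x
  have q_car: "carrier ?Q = q ` carrier V"
    by (auto simp: q_def quotient_module_def A_RCOSETS_def')
  have q_zero: "\<zero>\<^bsub>?Q\<^esub> = q \<zero>\<^bsub>V\<^esub>"
    using N.subset by (simp add: q_def quotient_module_def)
  have q_add: "q x \<oplus>\<^bsub>?Q\<^esub> q y = q (x \<oplus>\<^bsub>V\<^esub> y)" if "x \<in> carrier V" "y \<in> carrier V" for x y
    using A.a_rcos_sum[OF that] by (simp add: q_def quotient_module_def)
  have L_zero: "L r \<zero>\<^bsub>V\<^esub> = \<zero>\<^bsub>K\<^esub>" if "r \<in> R" for r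
    using N[of "\<zero>\<^bsub>V\<^esub>"] that by simp
  have L_neg: "L r (\<ominus>\<^bsub>V\<^esub> v) = \<ominus>\<^bsub>K\<^esub> L r v" if "r \<in> R" "v \<in> carrier V" for r v
  proof -
    have "L r (\<ominus>\<^bsub>V\<^esub> v) \<oplus>\<^bsub>K\<^esub> L r v = \<zero>\<^bsub>K\<^esub>"
      using L_add[of r "\<ominus>\<^bsub>V\<^esub> v" v] L_zero that by (simp add: V.M.l_neg)
    then show ?thesis using L that by (metis V.M.a_inv_closed V.R.minus_equality)
  qed
  have q_eq: "q u = q v \<longleftrightarrow> (\<forall>r\<in>R. L r u = L r v)" if uv: "u \<in> carrier V" "v \<in> carrier V" for u v
  proof -
    have "q u = q v \<longleftrightarrow> u \<in> N +>\<^bsub>V\<^esub> v"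
      unfolding q_def using uv A.a_repr_independence'[of u v] A.a_rcos_self[of u] by metis
    also have "\<dots> \<longleftrightarrow> u \<oplus>\<^bsub>V\<^esub> \<ominus>\<^bsub>V\<^esub> v \<in> N"
      using A.a_rcos_module[OF uv(2,1)] by simp
    also have "\<dots> \<longleftrightarrow> (\<forall>r\<in>R. L r u \<oplus>\<^bsub>K\<^esub> \<ominus>\<^bsub>K\<^esub> L r v = \<zero>\<^bsub>K\<^esub>)"
      using uv by (simp add: N L_add L_neg)
    also have "\<dots> \<longleftrightarrow> (\<forall>r\<in>R. L r u = L r v)"
      using uv L by (intro ball_cong refl) (metis V.R.r_neg V.R.minus_unique V.R.a_inv_closed V.R.minus_minus V.R.minus_equality)
    finally show ?thesis .
  qed
  have q_smult: "c \<odot>\<^bsub>?Q\<^esub> q x = q (c \<odot>\<^bsub>V\<^esub> x)" if "c \<in> carrier K" "x \<in> carrier V" for c x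
  proof -
    have "N +>\<^bsub>V\<^esub> (c \<odot>\<^bsub>V\<^esub> v) = q (c \<odot>\<^bsub>V\<^esub> x)" if v: "v \<in> q x" for v
    proof -
      have vV: "v \<in> carrier V"
        using v N.subset \<open>x \<in> carrier V\<close> by (auto simp: q_def a_r_coset_def')
      have "q v = q x"
        using v A.a_repr_independence'[of v x] \<open>x \<in> carrier V\<close> by (simp add: q_def)
      then have "q (c \<odot>\<^bsub>V\<^esub> v) = q (c \<odot>\<^bsub>V\<^esub> x)"
        using vV \<open>c \<in> _\<close> \<open>x \<in> _\<close> by (simp add: q_eq L_smult)
      then show ?thesis by (simp add: q_def)
    qed
    moreover have "x \<in> q x" using A.a_rcos_self that by (auto simp: q_def)
    ultimately show ?thesis by (auto simp: quotient_module_def)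
  qed
  have comb: "finsum V (\<lambda>r. c r \<odot>\<^bsub>V\<^esub> b r) S \<in> carrier V
      \<and> finsum ?Q (\<lambda>r. c r \<odot>\<^bsub>?Q\<^esub> q (b r)) S = q (finsum V (\<lambda>r. c r \<odot>\<^bsub>V\<^esub> b r) S)
      \<and> (\<forall>r\<in>R. L r (finsum V (\<lambda>r. c r \<odot>\<^bsub>V\<^esub> b r) S) = (if r \<in> S then c r else \<zero>\<^bsub>K\<^esub>))"
    if c: "c \<in> R \<rightarrow> carrier K" and S: "S \<subseteq> R" for c S
  proof -
    have "finite S" using S \<open>finite R\<close> by (rule finite_subset)
    then show ?thesis using S
    proof (induction S rule: finite_induct)
      case empty
      then show ?case by (simp add: q_zero L_zero)
    next
      case (insert s S)
      then have s: "s \<in> R" "c s \<in> carrier K" "b s \<in> carrier V" using c b by auto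
      have cb: "(\<lambda>r. c r \<odot>\<^bsub>V\<^esub> b r) \<in> S \<rightarrow> carrier V" using insert.prems c b by auto
      have cq: "(\<lambda>r. c r \<odot>\<^bsub>?Q\<^esub> q (b r)) \<in> S \<rightarrow> carrier ?Q"
        using insert.prems c b by (intro Pi_I Q.smult_closed) (auto simp: q_car)
      have sq: "c s \<odot>\<^bsub>?Q\<^esub> q (b s) \<in> carrier ?Q"
        using s by (intro Q.smult_closed) (auto simp: q_car)
      have 1: "finsum V (\<lambda>r. c r \<odot>\<^bsub>V\<^esub> b r) (insert s S) = c s \<odot>\<^bsub>V\<^esub> b s \<oplus>\<^bsub>V\<^esub> finsum V (\<lambda>r. c r \<odot>\<^bsub>V\<^esub> b r) S"
        using insert.hyps cb s by (intro V.M.finsum_insert) auto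
      have 2: "finsum ?Q (\<lambda>r. c r \<odot>\<^bsub>?Q\<^esub> q (b r)) (insert s S)
          = c s \<odot>\<^bsub>?Q\<^esub> q (b s) \<oplus>\<^bsub>?Q\<^esub> finsum ?Q (\<lambda>r. c r \<odot>\<^bsub>?Q\<^esub> q (b r)) S"
        using insert.hyps cq sq by (intro Q.M.finsum_insert) auto
      have IH: "finsum V (\<lambda>r. c r \<odot>\<^bsub>V\<^esub> b r) S \<in> carrier V"
        "finsum ?Q (\<lambda>r. c r \<odot>\<^bsub>?Q\<^esub> q (b r)) S = q (finsum V (\<lambda>r. c r \<odot>\<^bsub>V\<^esub> b r) S)"
        "\<And>r. r \<in> R \<Longrightarrow> L r (finsum V (\<lambda>r. c r \<odot>\<^bsub>V\<^esub> b r) S) = (if r \<in> S then c r else \<zero>\<^bsub>K\<^esub>)"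
        using insert.IH insert.prems by auto
      show ?case
        unfolding 1 2 using s IH insert.hyps funcset_mem[OF c]
        by (auto simp: q_smult q_add L_add L_smult L_b)
    qed
  qed
  have qb_inj: "inj_on (\<lambda>r. q (b r)) R"
  proof (rule inj_onI)
    fix r s assume rs: "r \<in> R" "s \<in> R" "q (b r) = q (b s)"
    then have "L r (b r) = L r (b s)" using b by (simp add: q_eq)
    then show "r = s" using rs by (auto simp: L_b split: if_splits)
  qed
  let ?B = "(\<lambda>r. q (b r)) ` R"
  have B: "finite ?B" "?B \<subseteq> carrier ?Q" using \<open>finite R\<close> b by (auto simp: q_car)
  have lincomb: "Q.lincomb a ?B = q (finsum V (\<lambda>r. a (q (b r)) \<odot>\<^bsub>V\<^esub> b r) R)" if a: "a \<in> ?B \<rightarrow> carrier K" for a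
  proof -
    have "Q.lincomb a ?B = finsum ?Q (\<lambda>r. a (q (b r)) \<odot>\<^bsub>?Q\<^esub> q (b r)) R"
      unfolding Q.lincomb_def using a qb_inj B by (subst Q.M.finsum_reindex) (auto intro!: Q.smult_closed)
    also have "\<dots> = q (finsum V (\<lambda>r. a (q (b r)) \<odot>\<^bsub>V\<^esub> b r) R)"
      using comb[of "\<lambda>r. a (q (b r))" R] a by auto
    finally show ?thesis .
  qed
  have "\<exists>!a. a \<in> ?B \<rightarrow>\<^sub>E carrier K \<and> Q.lincomb a ?B = C" if "C \<in> carrier ?Q" for C
  proof -
    from that obtain v where v: "v \<in> carrier V" "C = q v" by (auto simp: q_car)
    have iff: "Q.lincomb a ?B = C \<longleftrightarrow> (\<forall>r\<in>R. a (q (b r)) = L r v)" if a: "a \<in> ?B \<rightarrow> carrier K" for a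
      using comb[of "\<lambda>r. a (q (b r))" R] a v by (simp add: lincomb q_eq Pi_iff)
    define a0 where "a0 = (\<lambda>C\<in>?B. L (the_inv_into R (\<lambda>r. q (b r)) C) v)"
    have a0: "a0 (q (b r)) = L r v" if "r \<in> R" for r
      using that by (simp add: a0_def the_inv_into_f_f[OF qb_inj])
    have a0': "a0 \<in> ?B \<rightarrow>\<^sub>E carrier K"
      using a0 L v by (auto simp: a0_def PiE_iff extensional_def the_inv_into_f_f[OF qb_inj])
    show ?thesis
    proof (intro ex1I[of _ a0] conjI a0')
      show "Q.lincomb a0 ?B = C" using a0' a0 by (subst iff) auto
      fix a assume a: "a \<in> ?B \<rightarrow>\<^sub>E carrier K \<and> Q.lincomb a ?B = C"
      then have "a \<in> ?B \<rightarrow> carrier K" by (simp add: PiE_def)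
      then have "\<forall>r\<in>R. a (q (b r)) = L r v" using a iff by blast
      then show "a = a0" using a a0 a0' by (intro PiE_ext[of a ?B "\<lambda>_. carrier K" a0]) auto
    qed
  qed
  then have "Q.basis ?B" using B by (simp add: Q.basis_criterion)
  then have "Q.dim = card ?B" using B by (intro Q.dim_basis) auto
  then show ?thesis using qb_inj by (simp add: card_image)
qed

section \<open>Multilinear polynomials\<close>

lemma lookup_smult: "Poly_Mapping.lookup (Poly_Mapping.map ((*) (c :: rat)) f) w = c * Poly_Mapping.lookup f w"
  by (simp add: Poly_Mapping.map.rep_eq when_def)


text \<open>The set \<open>W\<close> is arbitrary in order to cover both the free algebra and its multilinear
  subspaces.\<close>

lemma free_algebra_span_vectorspace:
  "vectorspace class_ring ((free_algebra X)\<lparr>carrier := {f. Poly_Mapping.keys f \<subseteq> W}\<rparr>)"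
    (is "vectorspace _ ?V")
proof -
  have car: "f \<in> carrier ?V \<longleftrightarrow> (\<forall>w. w \<notin> W \<longrightarrow> Poly_Mapping.lookup f w = 0)" for f
    by (auto simp: in_keys_iff)
  have add: "f \<oplus>\<^bsub>?V\<^esub> g = f + g" and zero: "\<zero>\<^bsub>?V\<^esub> = 0"
    and smult: "c \<odot>\<^bsub>?V\<^esub> f = Poly_Mapping.map ((*) c) f" for f g c
    by (simp_all add: free_algebra_def)
  note eqs = poly_mapping_eqI lookup_smult lookup_add
  have "module class_ring ?V"
  proof (rule module_criteria)
    show "cring (class_ring :: rat ring)" by (rule class_cring.is_cring)
    show "\<forall>v\<in>carrier ?V. \<exists>w\<in>carrier ?V. v \<oplus>\<^bsub>?V\<^esub> w = \<zero>\<^bsub>?V\<^esub>"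
    proof
      fix v assume "v \<in> carrier ?V"
      then show "\<exists>w\<in>carrier ?V. v \<oplus>\<^bsub>?V\<^esub> w = \<zero>\<^bsub>?V\<^esub>"
        by (intro bexI[of _ "- v"]) (simp_all only: car add zero lookup_uminus, simp_all)
    qed
  qed (simp_all only: car add zero smult lookup_smult lookup_add lookup_zero;
       auto intro!: poly_mapping_eqI simp: lookup_smult lookup_add algebra_simps)+
  then show ?thesis
    by (intro vectorspace.intro class_field)
qed


lemma prod_list_fvar: "prod_list (map fvar xs) = Poly_Mapping.single (Word xs) 1"
proof (induction xs)
  case Nil
  then show ?case by (simp flip: zero_fmonoid_def)
next
  case (Cons x xs)
  then show ?case by (simp add: fvar_def mult_single plus_fmonoid_def)
qed

lemma free_algebra_finsum:
  assumes "finite A" "\<And>x. x \<in> A \<Longrightarrow> g x \<in> carrier (free_algebra X)"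
  shows "finsum (free_algebra X) g A = sum g A"
proof -
  let ?W = "{w. set (letters w) \<subseteq> X}"
  have "free_algebra X = (free_algebra X)\<lparr>carrier := {f. Poly_Mapping.keys f \<subseteq> ?W}\<rparr>"
    by (auto simp: free_algebra_def)
  then interpret F: vectorspace class_ring "free_algebra X"
    by (metis free_algebra_span_vectorspace)
  show ?thesis using assms
  proof (induction A rule: finite_induct)
    case empty
    have "finsum (free_algebra X) g {} = \<zero>\<^bsub>free_algebra X\<^esub>" by (rule F.M.finsum_empty)
    then show ?case by (simp only:) (simp add: free_algebra_def)
  next
    case (insert x A)
    then have "finsum (free_algebra X) g (insert x A) = g x \<oplus>\<^bsub>free_algebra X\<^esub> finsum (free_algebra X) g A"
      by (intro F.M.finsum_insert) auto
    moreover have "finsum (free_algebra X) g A = sum g A" using insert by auto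
    moreover have "f \<oplus>\<^bsub>free_algebra X\<^esub> h = f + h" for f h by (simp add: free_algebra_def)
    ultimately show ?case using insert.hyps by simp
  qed
qed

definition multilinear_words :: "('g, 'b) monoid_scheme \<Rightarrow> nat \<Rightarrow> (nat \<times> 'g) list set" where
  "multilinear_words G n = {xs. length xs = n \<and> fst ` set xs = {1..n} \<and> snd ` set xs \<subseteq> carrier G}"

lemma finite_multilinear_words:
  assumes "finite (carrier G)"
  shows "finite (multilinear_words G n)"
proof (rule finite_subset)
  show "multilinear_words G n \<subseteq> {xs. set xs \<subseteq> {1..n} \<times> carrier G \<and> length xs = n}"
    by (force simp: multilinear_words_def)
  show "finite {xs. set xs \<subseteq> {1..n} \<times> carrier G \<and> length xs = n}"
    using assms by (intro finite_lists_length_eq) auto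
qed

lemma distinct_multilinear_words:
  assumes "xs \<in> multilinear_words G n"
  shows "distinct (map fst xs)"
  using assms by (intro card_distinct) (simp add: multilinear_words_def)

lemma multilinear_words_vars: "xs \<in> multilinear_words G n \<Longrightarrow> set xs \<subseteq> graded_vars G"
  by (force simp: multilinear_words_def graded_vars_def)

lemma multilinear_space_eq:
  assumes "finite (carrier G)"
  shows "multilinear_space G n = {f. Poly_Mapping.keys f \<subseteq> Word ` multilinear_words G n}"
proof -
  let ?F = "free_algebra (graded_vars G)" and ?W = "{w. set (letters w) \<subseteq> graded_vars G}"
  let ?S = "\<lambda>xs. Poly_Mapping.single (Word xs) (1 :: rat)"
  let ?M = "multilinear_words G n"
  have "?F = ?F\<lparr>carrier := {f. Poly_Mapping.keys f \<subseteq> ?W}\<rparr>"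
    by (auto simp: free_algebra_def)
  then interpret F: vectorspace class_ring ?F
    by (metis free_algebra_span_vectorspace)
  have mons: "multilinear_monomials G n = ?S ` ?M"
    by (auto simp: multilinear_monomials_def multilinear_words_def prod_list_fvar)
  have inj: "inj_on ?S ?M"
    by (rule inj_onI) (metis fmonoid.inject keys_single singleton_inject zero_neq_one)
  have fin: "finite (?S ` ?M)" using finite_multilinear_words[OF assms] by simp
  have car: "?S ` ?M \<subseteq> carrier ?F"
    using multilinear_words_vars by (fastforce simp: free_algebra_def)
  have lookup: "Poly_Mapping.lookup (F.lincomb a (?S ` ?M)) (Word xs) = (if xs \<in> ?M then a (?S xs) else 0)" for a xs
  proof -
    have "F.lincomb a (?S ` ?M) = (\<Sum>m\<in>?S ` ?M. a m \<odot>\<^bsub>?F\<^esub> m)"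
      unfolding F.lincomb_def using fin car by (intro free_algebra_finsum F.smult_closed) auto
    also have "\<dots> = (\<Sum>xs\<in>?M. Poly_Mapping.map ((*) (a (?S xs))) (?S xs))"
      by (simp add: sum.reindex[OF inj] free_algebra_def)
    finally show ?thesis
      using finite_multilinear_words[OF assms, of n]
      by (simp add: lookup_sum lookup_smult lookup_single when_def sum.delta')
  qed
  have "multilinear_space G n = {F.lincomb a (?S ` ?M) | a. a \<in> ?S ` ?M \<rightarrow> carrier class_ring}"
    unfolding multilinear_space_def mons by (rule F.finite_span[OF fin car])
  also have "\<dots> = {f. Poly_Mapping.keys f \<subseteq> Word ` ?M}"
  proof (intro equalityI subsetI)
    fix f assume "f \<in> {F.lincomb a (?S ` ?M) | a. a \<in> ?S ` ?M \<rightarrow> carrier class_ring}"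
    then obtain a where f: "f = F.lincomb a (?S ` ?M)" by auto
    have "w \<in> Word ` ?M" if "w \<in> Poly_Mapping.keys f" for w
      using that lookup[of a "letters w"] unfolding f[symmetric]
      by (cases w) (auto simp: in_keys_iff split: if_splits)
    then show "f \<in> {f. Poly_Mapping.keys f \<subseteq> Word ` ?M}" by auto
  next
    fix f :: "(nat \<times> 'a) fmonoid \<Rightarrow>\<^sub>0 rat" assume f: "f \<in> {f. Poly_Mapping.keys f \<subseteq> Word ` ?M}"
    define a where "a m = Poly_Mapping.lookup f (the_elem (Poly_Mapping.keys m))" for m :: "(nat \<times> 'a) fmonoid \<Rightarrow>\<^sub>0 rat"
    have "Poly_Mapping.lookup f w = Poly_Mapping.lookup (F.lincomb a (?S ` ?M)) w" for w
    proof (cases w)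
      case (Word xs)
      have "Poly_Mapping.lookup f (Word xs) = 0" if "xs \<notin> ?M"
        using f that by (auto simp: in_keys_iff)
      then show ?thesis unfolding Word lookup by (simp add: a_def)
    qed
    then have "f = F.lincomb a (?S ` ?M)" by (intro poly_mapping_eqI)
    then show "f \<in> {F.lincomb a (?S ` ?M) | a. a \<in> ?S ` ?M \<rightarrow> carrier class_ring}" by auto
  qed
  finally show ?thesis .
qed

lemma index_mult_mat_sum:
  assumes "A \<in> carrier_mat k k" "B \<in> carrier_mat k k" "a < k" "b < k"
  shows "(A * B) $$ (a, b) = (\<Sum>c<k. A $$ (a, c) * B $$ (c, b))"
  using assms by (simp add: scalar_prod_def atLeast0LessThan)

lemma index_finsum_mat:
  assumes "finite A" "\<And>x. x \<in> A \<Longrightarrow> g x \<in> carrier_mat k k"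
  shows "finsum (ring_mat TYPE(complex) k b) g A \<in> carrier_mat k k
    \<and> (\<forall>i<k. \<forall>j<k. finsum (ring_mat TYPE(complex) k b) g A $$ (i, j) = (\<Sum>x\<in>A. g x $$ (i, j)))"
proof -
  interpret M: ring "ring_mat TYPE(complex) k b" by (rule ring_mat)
  show ?thesis using assms
  proof (induction A rule: finite_induct)
    case empty
    then show ?case using M.finsum_empty[of g] by (simp add: ring_mat_def)
  next
    case (insert x A)
    have "finsum (ring_mat TYPE(complex) k b) g (insert x A)
        = g x \<oplus>\<^bsub>ring_mat TYPE(complex) k b\<^esub> finsum (ring_mat TYPE(complex) k b) g A"
      using insert by (intro M.finsum_insert) (auto simp: ring_mat_simps)
    with insert show ?case by (auto simp: ring_mat_simps)
  qed
qed

section \<open>Words as walks\<close>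

text \<open>A factor of degree \<open>g\<close> has nonzero entries only at positions \<open>(v, g\<^sup>-\<^sup>1v)\<close>. Reading a word from left to
  right is therefore a walk, and \<open>edge_map\<close> records the arc that is passed while reading the variable with
  a given index. The value \<open>undefined\<close> at the other indices makes the map extensional, as the elements
  of \<^const>\<open>eulerian_digraphs\<close> are.\<close>

primrec edge_map :: "('g, 'b) monoid_scheme \<Rightarrow> 'g \<Rightarrow> ('i \<times> 'g) list \<Rightarrow> 'i \<Rightarrow> 'g \<times> 'g" where
  "edge_map G v [] = (\<lambda>_. undefined)"
| "edge_map G v (x # xs) = (edge_map G (inv\<^bsub>G\<^esub> snd x \<otimes>\<^bsub>G\<^esub> v) xs)(fst x := (v, inv\<^bsub>G\<^esub> snd x \<otimes>\<^bsub>G\<^esub> v))"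

primrec walk_end :: "('g, 'b) monoid_scheme \<Rightarrow> 'g \<Rightarrow> ('i \<times> 'g) list \<Rightarrow> 'g" where
  "walk_end G v [] = v"
| "walk_end G v (x # xs) = walk_end G (inv\<^bsub>G\<^esub> snd x \<otimes>\<^bsub>G\<^esub> v) xs"

text \<open>Here \<open>y x v\<close> is the entry in row \<open>v\<close> of the matrix substituted for the variable \<open>x\<close>.\<close>

primrec walk_weight :: "('g, 'b) monoid_scheme \<Rightarrow> ('i \<times> 'g \<Rightarrow> 'g \<Rightarrow> complex) \<Rightarrow> 'g \<Rightarrow> ('i \<times> 'g) list \<Rightarrow> complex" where
  "walk_weight G y v [] = 1"
| "walk_weight G y v (x # xs) = y x v * walk_weight G y (inv\<^bsub>G\<^esub> snd x \<otimes>\<^bsub>G\<^esub> v) xs"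

context group
begin

lemma edge_map_PiE:
  assumes "snd ` set xs \<subseteq> carrier G" "v \<in> carrier G"
  shows "edge_map G v xs \<in> fst ` set xs \<rightarrow>\<^sub>E carrier G \<times> carrier G"
  using assms
proof (induction xs arbitrary: v)
  case (Cons x xs)
  then have "edge_map G (inv (snd x) \<otimes> v) xs \<in> fst ` set xs \<rightarrow>\<^sub>E carrier G \<times> carrier G"
    by (intro Cons.IH) auto
  then show ?case using Cons.prems by (auto simp: PiE_iff extensional_def)
qed simp

lemma is_trail_edge_map:
  assumes "distinct (map fst xs)"
  shows "is_trail (edge_map G v xs) v (map fst xs)"
  using assms
proof (induction xs arbitrary: v)
  case (Cons x xs)
  let ?w = "inv (snd x) \<otimes> v"
  have "is_trail (edge_map G v (x # xs)) ?w (map fst xs) = is_trail (edge_map G ?w xs) ?w (map fst xs)"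
  proof (rule is_trail_cong)
    fix i assume "i \<in> set (map fst xs)"
    then have "i \<noteq> fst x" using Cons.prems unfolding list.map distinct.simps by metis
    then show "edge_map G v (x # xs) i = edge_map G ?w xs i" by simp
  qed
  then show ?case using Cons by (simp del: fun_upd_apply add: fun_upd_same)
qed simp

lemma trail_end_edge_map:
  assumes "distinct (map fst xs)"
  shows "trail_end (edge_map G v xs) v (map fst xs) = walk_end G v xs"
  using assms
proof (induction xs arbitrary: v)
  case (Cons x xs)
  let ?w = "inv (snd x) \<otimes> v"
  have "trail_end (edge_map G v (x # xs)) ?w (map fst xs) = trail_end (edge_map G ?w xs) ?w (map fst xs)"
  proof (rule trail_end_cong)
    fix i assume "i \<in> set (map fst xs)"
    then have "i \<noteq> fst x" using Cons.prems unfolding list.map distinct.simps by metis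
    then show "edge_map G v (x # xs) i = edge_map G ?w xs i" by simp
  qed
  then show ?case using Cons by (simp del: fun_upd_apply add: fun_upd_same)
qed simp

lemma walk_end_closed:
  assumes "snd ` set xs \<subseteq> carrier G" "v \<in> carrier G"
  shows "walk_end G v xs \<in> carrier G"
  using assms by (induction xs arbitrary: v) auto

lemma walk_end_translate:
  assumes "snd ` set xs \<subseteq> carrier G" "v \<in> carrier G" "a \<in> carrier G"
  shows "walk_end G (v \<otimes> a) xs = walk_end G v xs \<otimes> a"
  using assms by (induction xs arbitrary: v) (auto simp flip: m_assoc)

text \<open>Right translation by \<open>a\<close> commutes with the left multiplications that make up a walk. So the weights
  of all walks along a word, from whatever row, are functions of the arcs of the walk
  from \<open>v\<close>.\<close>

lemma walk_weight_edge_map: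
  assumes "distinct (map fst xs)" "snd ` set xs \<subseteq> carrier G" "v \<in> carrier G" "a \<in> carrier G"
  shows "walk_weight G y (v \<otimes> a) xs = (\<Prod>i\<in>fst ` set xs.
    y (i, fst (edge_map G v xs i) \<otimes> inv (snd (edge_map G v xs i))) (fst (edge_map G v xs i) \<otimes> a))"
  using assms
proof (induction xs arbitrary: v)
  case (Cons x xs)
  let ?w = "inv (snd x) \<otimes> v" and ?E = "edge_map G v (x # xs)"
  have x: "snd x \<in> carrier G" "v \<in> carrier G" "?w \<in> carrier G" using Cons.prems by auto
  have "v \<otimes> inv ?w = snd x"
    using x by (simp add: inv_mult_group flip: m_assoc)
  then have head: "y (fst x, fst (?E (fst x)) \<otimes> inv (snd (?E (fst x)))) (fst (?E (fst x)) \<otimes> a) = y x (v \<otimes> a)"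
    by simp
  have "walk_weight G y (v \<otimes> a) (x # xs) = y x (v \<otimes> a) * walk_weight G y (?w \<otimes> a) xs"
    using x Cons.prems by (simp add: m_assoc)
  also have "walk_weight G y (?w \<otimes> a) xs = (\<Prod>i\<in>fst ` set xs.
      y (i, fst (edge_map G ?w xs i) \<otimes> inv (snd (edge_map G ?w xs i))) (fst (edge_map G ?w xs i) \<otimes> a))"
    using x Cons.prems by (intro Cons.IH) auto
  also have "\<dots> = (\<Prod>i\<in>fst ` set xs. y (i, fst (?E i) \<otimes> inv (snd (?E i))) (fst (?E i) \<otimes> a))"
  proof (rule prod.cong[OF refl])
    fix i assume "i \<in> fst ` set xs"
    then have "i \<noteq> fst x" using Cons.prems(1) unfolding list.map distinct.simps set_map by metis
    then show "y (i, fst (edge_map G ?w xs i) \<otimes> inv (snd (edge_map G ?w xs i))) (fst (edge_map G ?w xs i) \<otimes> a)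
        = y (i, fst (?E i) \<otimes> inv (snd (?E i))) (fst (?E i) \<otimes> a)" by simp
  qed
  also have "y x (v \<otimes> a) * \<dots> = (\<Prod>i\<in>insert (fst x) (fst ` set xs). y (i, fst (?E i) \<otimes> inv (snd (?E i))) (fst (?E i) \<otimes> a))"
    unfolding head[symmetric] using Cons.prems by (subst prod.insert) auto
  finally show ?case by simp
qed simp

text \<open>A trail is turned into a word by giving the arc \<open>(u, w)\<close> the degree \<open>u w\<^sup>-\<^sup>1\<close>.\<close>

lemma edge_map_surj:
  assumes "is_trail f v p" "distinct p" "f \<in> set p \<rightarrow>\<^sub>E carrier G \<times> carrier G"
  shows "edge_map G v (map (\<lambda>i. (i, fst (f i) \<otimes> inv (snd (f i)))) p) = f"
proof -
  let ?E = "\<lambda>v p. edge_map G v (map (\<lambda>i. (i, fst (f i) \<otimes> inv (snd (f i)))) p)"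
  have "?E v p i = (if i \<in> set p then f i else undefined)"
    if "is_trail f v p" "distinct p" "\<And>i. i \<in> set p \<Longrightarrow> f i \<in> carrier G \<times> carrier G" for i
    using that
  proof (induction p arbitrary: v)
    case (Cons j p)
    then have fj: "fst (f j) = v" "v \<in> carrier G" "snd (f j) \<in> carrier G"
      by (auto simp: mem_Times_iff)
    then have "inv (fst (f j) \<otimes> inv (snd (f j))) \<otimes> v = snd (f j)"
      by (simp add: inv_mult_group m_assoc)
    moreover have "?E (snd (f j)) p i = (if i \<in> set p then f i else undefined)"
      using Cons.prems by (intro Cons.IH) auto
    ultimately show ?case using fj by (auto simp: prod_eq_iff)
  qed simp
  from this[OF assms(1,2)] show ?thesis
    using assms(3) by (auto simp: fun_eq_iff PiE_iff extensional_def)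
qed

lemma edge_map_image_multilinear_words:
  "edge_map G \<one> ` multilinear_words G n = eulerian_digraphs {1..n} (carrier G) \<one>"
proof (intro equalityI subsetI)
  fix f assume "f \<in> edge_map G \<one> ` multilinear_words G n"
  then obtain xs where xs: "xs \<in> multilinear_words G n" "f = edge_map G \<one> xs" by auto
  then show "f \<in> eulerian_digraphs {1..n} (carrier G) \<one>"
    using is_trail_edge_map[OF distinct_multilinear_words[OF xs(1)], of \<one>] edge_map_PiE[of xs \<one>]
      distinct_multilinear_words[OF xs(1)]
    by (auto simp: eulerian_digraphs_def multilinear_words_def intro!: exI[of _ "map fst xs"])
next
  fix f assume "f \<in> eulerian_digraphs {1..n} (carrier G) \<one>"
  then obtain p where p: "is_trail f \<one> p" "distinct p" "set p = {1..n}"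
    and f: "f \<in> set p \<rightarrow>\<^sub>E carrier G \<times> carrier G"
    by (auto simp: eulerian_digraphs_def)
  let ?xs = "map (\<lambda>i. (i, fst (f i) \<otimes> inv (snd (f i)))) p"
  have "length p = n" using distinct_card[OF p(2)] p(3) by simp
  moreover have "f i \<in> carrier G \<times> carrier G" if "i \<in> set p" for i using f that by auto
  ultimately have "?xs \<in> multilinear_words G n"
    using p(3) by (auto simp: multilinear_words_def image_image mem_Times_iff)
  then show "f \<in> edge_map G \<one> ` multilinear_words G n"
    by (intro image_eqI[where x = ?xs] edge_map_surj[OF p(1,2) f, symmetric])
qed


lemma edge_map_eq_imp_walk_end_eq:
  assumes xs: "xs \<in> multilinear_words G n" and ys: "ys \<in> multilinear_words G n"
    and eq: "edge_map G \<one> xs = edge_map G \<one> ys"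
  shows "walk_end G \<one> xs = walk_end G \<one> ys"
proof -
  note dist = distinct_multilinear_words[OF xs] distinct_multilinear_words[OF ys]
  have "trail_end (edge_map G \<one> ys) \<one> (map fst xs) = trail_end (edge_map G \<one> ys) \<one> (map fst ys)"
    using is_trail_edge_map[OF dist(1), of \<one>] is_trail_edge_map[OF dist(2), of \<one>] dist xs ys eq
    by (intro trail_end_unique) (auto simp: multilinear_words_def)
  then show ?thesis
    using trail_end_edge_map[OF dist(1), of \<one>] trail_end_edge_map[OF dist(2), of \<one>] eq by simp
qed

lemma edge_map_eq_imp_walk_weight_eq:
  assumes xs: "xs \<in> multilinear_words G n" and ys: "ys \<in> multilinear_words G n"
    and eq: "edge_map G \<one> xs = edge_map G \<one> ys" and a: "a \<in> carrier G"
  shows "walk_weight G y a xs = walk_weight G y a ys"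
  using walk_weight_edge_map[OF distinct_multilinear_words[OF xs], of \<one> a y]
    walk_weight_edge_map[OF distinct_multilinear_words[OF ys], of \<one> a y] xs ys eq a
  by (simp add: multilinear_words_def)

text \<open>The substitution that separates the arc map \<open>f\<close> from all other arc maps.\<close>

lemma walk_weight_indicator:
  assumes xs: "xs \<in> multilinear_words G n" and f: "f \<in> {1..n} \<rightarrow>\<^sub>E carrier G \<times> carrier G"
  defines "y \<equiv> \<lambda>x v. of_bool (v = fst (f (fst x)) \<and> snd x = v \<otimes> inv (snd (f (fst x))))"
  shows "walk_weight G y \<one> xs = of_bool (edge_map G \<one> xs = f)"
proof -
  let ?E = "edge_map G \<one> xs"
  have W: "fst ` set xs = {1..n}" "snd ` set xs \<subseteq> carrier G"
    using xs by (auto simp: multilinear_words_def)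
  have E: "?E \<in> {1..n} \<rightarrow>\<^sub>E carrier G \<times> carrier G"
    using edge_map_PiE[OF W(2), of \<one>] W(1) by simp
  have y: "y (i, fst (?E i) \<otimes> inv (snd (?E i))) (fst (?E i) \<otimes> \<one>) = of_bool (?E i = f i)" if "i \<in> {1..n}" for i
  proof -
    have "?E i \<in> carrier G \<times> carrier G" "f i \<in> carrier G \<times> carrier G"
      using PiE_mem[OF E that] PiE_mem[OF f that] by auto
    then show ?thesis by (auto simp: y_def mem_Times_iff prod_eq_iff)
  qed
  have "walk_weight G y \<one> xs = (\<Prod>i\<in>{1..n}. of_bool (?E i = f i))"
    using walk_weight_edge_map[OF distinct_multilinear_words[OF xs] W(2), of \<one> \<one> y] W y by simp
  also have "\<dots> = of_bool (\<forall>i\<in>{1..n}. ?E i = f i)"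
    by (auto intro: prod.neutral)
  also have "(\<forall>i\<in>{1..n}. ?E i = f i) \<longleftrightarrow> ?E = f"
    using PiE_ext[OF E f] by auto
  finally show ?thesis .
qed

section \<open>The graded codimension\<close>

text \<open>Every factor has at most one nonzero entry in each row, so only the summand that follows the walk
  survives in a product of such matrices.\<close>

lemma index_subst_word:
  assumes e: "bij_betw e {..<k} (carrier G)" and xs: "snd ` set xs \<subseteq> carrier G"
    and car: "\<And>x. x \<in> set xs \<Longrightarrow> \<phi> x \<in> carrier_mat k k"
    and ent: "\<And>x a b. x \<in> set xs \<Longrightarrow> a < k \<Longrightarrow> b < k \<Longrightarrow>
       \<phi> x $$ (a, b) = (if e a = snd x \<otimes> e b then y x (e a) else 0)"
  shows "foldr (\<lambda>x A. \<phi> x * A) xs (1\<^sub>m k) \<in> carrier_mat k k \<and>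
    (\<forall>a<k. \<forall>b<k. foldr (\<lambda>x A. \<phi> x * A) xs (1\<^sub>m k) $$ (a, b) =
       (if e b = walk_end G (e a) xs then walk_weight G y (e a) xs else 0))"
  using xs car ent
proof (induction xs)
  case Nil
  have "e b = e a \<longleftrightarrow> b = a" if "a < k" "b < k" for a b
    using e that by (auto simp: bij_betw_def inj_on_def)
  then show ?case by auto
next
  case (Cons x xs)
  let ?M = "foldr (\<lambda>x A. \<phi> x * A) xs (1\<^sub>m k)"
  have IH: "?M \<in> carrier_mat k k" "\<And>a b. a < k \<Longrightarrow> b < k \<Longrightarrow>
      ?M $$ (a, b) = (if e b = walk_end G (e a) xs then walk_weight G y (e a) xs else 0)"
    using Cons.IH Cons.prems by auto
  have x: "snd x \<in> carrier G" "\<phi> x \<in> carrier_mat k k" using Cons.prems by auto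
  have "(\<phi> x * ?M) $$ (a, b) = (if e b = walk_end G (inv (snd x) \<otimes> e a) xs
      then y x (e a) * walk_weight G y (inv (snd x) \<otimes> e a) xs else 0)" if ab: "a < k" "b < k" for a b
  proof -
    have ea: "e a \<in> carrier G" using e ab by (auto simp: bij_betw_def)
    then have "inv (snd x) \<otimes> e a \<in> e ` {..<k}" using x e by (auto simp: bij_betw_def)
    then obtain c0 where c0: "c0 < k" "e c0 = inv (snd x) \<otimes> e a" by auto
    have iff: "e a = snd x \<otimes> e c \<longleftrightarrow> c = c0" if "c < k" for c
    proof -
      have "e c \<in> carrier G" using e that by (auto simp: bij_betw_def)
      then have "e a = snd x \<otimes> e c \<longleftrightarrow> e c = e c0"
        unfolding c0(2) using inv_solve_left[of "e c" "snd x" "e a"] x ea by simp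
      also have "\<dots> \<longleftrightarrow> c = c0"
        using e that c0(1) by (auto simp: bij_betw_def inj_on_def)
      finally show ?thesis .
    qed
    have "(\<phi> x * ?M) $$ (a, b) = (\<Sum>c<k. \<phi> x $$ (a, c) * ?M $$ (c, b))"
      by (rule index_mult_mat_sum[OF x(2) IH(1) ab])
    also have "\<dots> = (\<Sum>c<k. if c = c0 then y x (e a) * ?M $$ (c, b) else 0)"
      using ab iff Cons.prems(3)[of x a] by (intro sum.cong refl) auto
    also have "\<dots> = y x (e a) * ?M $$ (c0, b)" using c0 by simp
    finally show ?thesis using IH(2)[OF c0(1) ab(2)] c0(2) by simp
  qed
  then show ?case using x IH(1) by auto
qed

lemma index_crossed_component:
  assumes "Coset.order G = k" "D \<in> diag_mats k" "a < k" "b < k"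
  shows "(D * perm_mat G e g) $$ (a, b) = (if e a = g \<otimes> e b then D $$ (a, a) else 0)"
proof -
  have D: "D \<in> carrier_mat k k" "\<And>c. c < k \<Longrightarrow> c \<noteq> a \<Longrightarrow> D $$ (a, c) = 0"
    using assms by (auto simp: diag_mats_def diagonal_mat_def)
  have P: "perm_mat G e g \<in> carrier_mat k k"
    using assms by (simp add: perm_mat_def)
  have "(D * perm_mat G e g) $$ (a, b) = (\<Sum>c<k. D $$ (a, c) * perm_mat G e g $$ (c, b))"
    by (rule index_mult_mat_sum[OF D(1) P assms(3,4)])
  also have "\<dots> = (\<Sum>c<k. if c = a then D $$ (a, a) * perm_mat G e g $$ (a, b) else 0)"
    using D(2) by (intro sum.cong refl) auto
  also have "\<dots> = D $$ (a, a) * perm_mat G e g $$ (a, b)" using assms by simp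
  finally show ?thesis using assms by (simp add: perm_mat_def)
qed

lemma mem_crossed_componentE:
  assumes "Coset.order G = k" "bij_betw e {..<k} (carrier G)" "A \<in> crossed_component G e g"
  obtains d where "A \<in> carrier_mat k k"
    "\<And>a b. a < k \<Longrightarrow> b < k \<Longrightarrow> A $$ (a, b) = (if e a = g \<otimes> e b then d (e a) else 0)"
proof -
  from assms obtain D where D: "D \<in> diag_mats k" "A = D * perm_mat G e g"
    by (auto simp: crossed_component_def)
  show thesis
  proof (rule that[of "\<lambda>v. D $$ (the_inv_into {..<k} e v, the_inv_into {..<k} e v)"])
    show "A \<in> carrier_mat k k"
      using D assms by (auto simp: diag_mats_def perm_mat_def)
    fix a b assume "a < k" "b < k"
    moreover from this have "the_inv_into {..<k} e (e a) = a"
      using assms(2) by (intro the_inv_into_f_f) (auto simp: bij_betw_def)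
    ultimately show "A $$ (a, b) = (if e a = g \<otimes> e b
        then D $$ (the_inv_into {..<k} e (e a), the_inv_into {..<k} e (e a)) else 0)"
      by (simp only: D(2) index_crossed_component[OF assms(1) D(1)])
  qed
qed

lemma index_subst_mat:
  assumes ord: "Coset.order G = k" and e: "bij_betw e {..<k} (carrier G)" and "finite (carrier G)"
    and f: "Poly_Mapping.keys f \<subseteq> Word ` multilinear_words G n"
    and car: "\<And>x. x \<in> graded_vars G \<Longrightarrow> \<phi> x \<in> carrier_mat k k"
    and ent: "\<And>x a b. x \<in> graded_vars G \<Longrightarrow> a < k \<Longrightarrow> b < k \<Longrightarrow>
       \<phi> x $$ (a, b) = (if e a = snd x \<otimes> e b then y x (e a) else 0)"
  shows "subst_mat k \<phi> f \<in> carrier_mat k k"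
    and "a < k \<Longrightarrow> b < k \<Longrightarrow> subst_mat k \<phi> f $$ (a, b)
      = (\<Sum>xs\<in>multilinear_words G n. of_rat (Poly_Mapping.lookup f (Word xs)) *
           (if e b = walk_end G (e a) xs then walk_weight G y (e a) xs else 0))"
proof -
  let ?M = "\<lambda>w. foldr (\<lambda>x A. \<phi> x * A) (letters w) (1\<^sub>m k)"
  let ?g = "\<lambda>w. of_rat (Poly_Mapping.lookup f w) \<cdot>\<^sub>m ?M w"
  have M: "?M (Word xs) \<in> carrier_mat k k"
      "\<And>a b. a < k \<Longrightarrow> b < k \<Longrightarrow> ?M (Word xs) $$ (a, b) =
       (if e b = walk_end G (e a) xs then walk_weight G y (e a) xs else 0)"
    if "xs \<in> multilinear_words G n" for xs
  proof -
    have "snd ` set xs \<subseteq> carrier G" using that by (simp add: multilinear_words_def)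
    from index_subst_word[OF e this, of \<phi> y] multilinear_words_vars[OF that] car ent
    show "?M (Word xs) \<in> carrier_mat k k"
      "\<And>a b. a < k \<Longrightarrow> b < k \<Longrightarrow> ?M (Word xs) $$ (a, b) =
       (if e b = walk_end G (e a) xs then walk_weight G y (e a) xs else 0)"
      by (auto simp: subset_iff)
  qed
  have g: "?g w \<in> carrier_mat k k" if "w \<in> Poly_Mapping.keys f" for w
    using f that M by auto
  note fs = index_finsum_mat[of "Poly_Mapping.keys f" ?g k "()", OF finite_keys g]
  show "subst_mat k \<phi> f \<in> carrier_mat k k"
    unfolding subst_mat_def using fs by blast
  assume ab: "a < k" "b < k"
  have "subst_mat k \<phi> f $$ (a, b) = (\<Sum>w\<in>Poly_Mapping.keys f. ?g w $$ (a, b))"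
    unfolding subst_mat_def using fs ab by blast
  also have "\<dots> = (\<Sum>w\<in>Poly_Mapping.keys f. of_rat (Poly_Mapping.lookup f w) * ?M w $$ (a, b))"
  proof (rule sum.cong[OF refl])
    fix w assume "w \<in> Poly_Mapping.keys f"
    then have "?M w \<in> carrier_mat k k" using f M by auto
    then show "?g w $$ (a, b) = of_rat (Poly_Mapping.lookup f w) * ?M w $$ (a, b)" using ab by simp
  qed
  also have "\<dots> = (\<Sum>w\<in>Word ` multilinear_words G n. of_rat (Poly_Mapping.lookup f w) * ?M w $$ (a, b))"
    using f finite_multilinear_words[OF assms(3)]
    by (intro sum.mono_neutral_left) (auto simp: in_keys_iff)
  also have "\<dots> = (\<Sum>xs\<in>multilinear_words G n. of_rat (Poly_Mapping.lookup f (Word xs)) *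
      (if e b = walk_end G (e a) xs then walk_weight G y (e a) xs else 0))"
    using M(2) ab by (subst sum.reindex) (auto simp: inj_on_def intro!: sum.cong)
  finally show "subst_mat k \<phi> f $$ (a, b) = \<dots>" .
qed

definition class_sum :: "nat \<Rightarrow> (nat \<Rightarrow> 'a \<times> 'a) \<Rightarrow> ((nat \<times> 'a) fmonoid \<Rightarrow>\<^sub>0 rat) \<Rightarrow> rat" where
  "class_sum n t f = (\<Sum>xs\<in>{xs \<in> multilinear_words G n. edge_map G \<one> xs = t}. Poly_Mapping.lookup f (Word xs))"

text \<open>Words with equal arc maps have equal values, so vanishing class sums suffice. They are also necessary:
  substituting the indicator of an arc map \<open>t\<close> makes the entry in row \<open>1\<close> at the column where the walks
  of \<open>t\<close> end equal to the class sum of \<open>t\<close>.\<close>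

lemma graded_identity_iff:
  assumes ord: "Coset.order G = k" and e: "bij_betw e {..<k} (carrier G)" and fin: "finite (carrier G)"
    and f: "Poly_Mapping.keys f \<subseteq> Word ` multilinear_words G n"
  shows "f \<in> graded_identities G e \<longleftrightarrow>
    (\<forall>t\<in>eulerian_digraphs {1..n} (carrier G) \<one>. class_sum n t f = 0)"
proof
  let ?W = "multilinear_words G n"
  assume id: "f \<in> graded_identities G e"
  show "\<forall>t\<in>eulerian_digraphs {1..n} (carrier G) \<one>. class_sum n t f = 0"
  proof
    fix t assume t: "t \<in> eulerian_digraphs {1..n} (carrier G) \<one>"
    then obtain ys where ys: "ys \<in> ?W" "t = edge_map G \<one> ys"
      unfolding edge_map_image_multilinear_words[symmetric] by auto
    have tPi: "t \<in> {1..n} \<rightarrow>\<^sub>E carrier G \<times> carrier G"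
      using t by (simp add: eulerian_digraphs_def)
    define y :: "nat \<times> 'a \<Rightarrow> 'a \<Rightarrow> complex" where
      "y = (\<lambda>x v. of_bool (v = fst (t (fst x)) \<and> snd x = v \<otimes> inv (snd (t (fst x)))))"
    define D where "D x = Matrix.mat k k (\<lambda>(a, b). if a = b then y x (e a) else 0)" for x
    define \<phi> where "\<phi> x = D x * perm_mat G e (snd x)" for x
    have D: "D x \<in> diag_mats k" for x
      by (auto simp: diag_mats_def D_def diagonal_mat_def)
    have car: "\<phi> x \<in> carrier_mat k k" for x
      using ord unfolding \<phi>_def by (intro mult_carrier_mat[of _ k k]) (simp_all add: D_def perm_mat_def)
    have ent: "\<phi> x $$ (a, b) = (if e a = snd x \<otimes> e b then y x (e a) else 0)" if "a < k" "b < k" for x a b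
      using that unfolding \<phi>_def index_crossed_component[OF ord D that] by (simp add: D_def)
    have "\<phi> (i, g) \<in> crossed_component G e g" for i g
      using D ord by (auto simp: crossed_component_def \<phi>_def)
    then have zero: "subst_mat k \<phi> f = 0\<^sub>m k k"
      using id ord by (auto simp: graded_identities_def)
    have img: "e ` {..<k} = carrier G" using e by (simp add: bij_betw_def)
    then obtain a where a: "a < k" "e a = \<one>" by (metis one_closed imageE lessThan_iff)
    have "walk_end G \<one> ys \<in> carrier G"
      using ys by (intro walk_end_closed) (auto simp: multilinear_words_def)
    then obtain b where b: "b < k" "e b = walk_end G \<one> ys" using img by (metis imageE lessThan_iff)
    have "0 = subst_mat k \<phi> f $$ (a, b)" using a b by (simp add: zero)
    also have "\<dots> = (\<Sum>xs\<in>?W. of_rat (Poly_Mapping.lookup f (Word xs)) *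
           (if e b = walk_end G \<one> xs then walk_weight G y \<one> xs else 0))"
      using index_subst_mat(2)[OF ord e fin f car ent a(1) b(1)] by (simp only: a(2))
    also have "\<dots> = (\<Sum>xs\<in>?W. if edge_map G \<one> xs = t then of_rat (Poly_Mapping.lookup f (Word xs)) else 0)"
    proof (rule sum.cong[OF refl])
      fix xs assume xs: "xs \<in> ?W"
      have "walk_weight G y \<one> xs = of_bool (edge_map G \<one> xs = t)"
        unfolding y_def by (rule walk_weight_indicator[OF xs tPi])
      moreover have "e b = walk_end G \<one> xs" if "edge_map G \<one> xs = t"
        using edge_map_eq_imp_walk_end_eq[OF xs ys(1)] that ys b by simp
      ultimately show "of_rat (Poly_Mapping.lookup f (Word xs)) *
           (if e b = walk_end G \<one> xs then walk_weight G y \<one> xs else 0)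
          = (if edge_map G \<one> xs = t then of_rat (Poly_Mapping.lookup f (Word xs)) else 0 :: complex)" by auto
    qed
    also have "\<dots> = (\<Sum>xs\<in>{xs \<in> ?W. edge_map G \<one> xs = t}. of_rat (Poly_Mapping.lookup f (Word xs)))"
      using finite_multilinear_words[OF fin] by (intro sum.inter_filter[symmetric])
    also have "\<dots> = of_rat (class_sum n t f)"
      by (simp add: class_sum_def of_rat_sum)
    finally show "class_sum n t f = 0" by simp
  qed
next
  let ?W = "multilinear_words G n"
  assume cs: "\<forall>t\<in>eulerian_digraphs {1..n} (carrier G) \<one>. class_sum n t f = 0"
  have zero: "subst_mat k \<phi> f = 0\<^sub>m k k"
    if \<phi>: "\<And>x. x \<in> graded_vars G \<Longrightarrow> \<phi> x \<in> crossed_component G e (snd x)" for \<phi>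
  proof -
    have "\<forall>x\<in>graded_vars G. \<exists>d. \<forall>a<k. \<forall>b<k. \<phi> x $$ (a, b) = (if e a = snd x \<otimes> e b then d (e a) else 0)"
      using \<phi> by (metis mem_crossed_componentE[OF ord e])
    then obtain y where y: "\<forall>x\<in>graded_vars G. \<forall>a<k. \<forall>b<k. \<phi> x $$ (a, b) = (if e a = snd x \<otimes> e b then y x (e a) else 0)"
      by metis
    have car: "\<phi> x \<in> carrier_mat k k" if "x \<in> graded_vars G" for x
      using \<phi>[OF that] by (rule mem_crossed_componentE[OF ord e])
    have ent: "\<phi> x $$ (a, b) = (if e a = snd x \<otimes> e b then y x (e a) else 0)"
      if "x \<in> graded_vars G" "a < k" "b < k" for x a b
      using y that by blast
    have "subst_mat k \<phi> f $$ (a, b) = 0" if ab: "a < k" "b < k" for a b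
    proof -
      have ea: "e a \<in> carrier G" using e ab by (auto simp: bij_betw_def)
      define m where "m xs = (if e b = walk_end G (e a) xs then walk_weight G y (e a) xs else 0)" for xs
      have m_eq: "m xs = m ys" if "xs \<in> ?W" "ys \<in> ?W" "edge_map G \<one> xs = edge_map G \<one> ys" for xs ys
        using walk_end_translate[of xs \<one> "e a"] walk_end_translate[of ys \<one> "e a"] ea that
          edge_map_eq_imp_walk_end_eq[OF that] edge_map_eq_imp_walk_weight_eq[OF that ea, of y]
        by (simp add: m_def multilinear_words_def)
      have "subst_mat k \<phi> f $$ (a, b) = (\<Sum>xs\<in>?W. of_rat (Poly_Mapping.lookup f (Word xs)) * m xs)"
        unfolding m_def by (rule index_subst_mat(2)[OF ord e fin f car ent ab])
      also have "\<dots> = (\<Sum>t\<in>edge_map G \<one> ` ?W. \<Sum>xs\<in>{xs \<in> ?W. edge_map G \<one> xs = t}. of_rat (Poly_Mapping.lookup f (Word xs)) * m xs)"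
        by (rule sum.image_gen[OF finite_multilinear_words[OF fin]])
      also have "\<dots> = 0"
      proof (rule sum.neutral, rule ballI)
        fix t assume "t \<in> edge_map G \<one> ` ?W"
        then obtain ys where ys: "ys \<in> ?W" "t = edge_map G \<one> ys" by auto
        have "(\<Sum>xs\<in>{xs \<in> ?W. edge_map G \<one> xs = t}. of_rat (Poly_Mapping.lookup f (Word xs)) * m xs)
            = (\<Sum>xs\<in>{xs \<in> ?W. edge_map G \<one> xs = t}. of_rat (Poly_Mapping.lookup f (Word xs)) * m ys)"
        proof (rule sum.cong[OF refl])
          fix xs assume "xs \<in> {xs \<in> ?W. edge_map G \<one> xs = t}"
          then have "m xs = m ys" using ys by (intro m_eq) auto
          then show "of_rat (Poly_Mapping.lookup f (Word xs)) * m xs = of_rat (Poly_Mapping.lookup f (Word xs)) * m ys"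
            by simp
        qed
        also have "\<dots> = of_rat (class_sum n t f) * m ys"
          by (simp add: class_sum_def of_rat_sum sum_distrib_right)
        also have "class_sum n t f = 0"
          using cs ys unfolding edge_map_image_multilinear_words[symmetric] by auto
        finally show "(\<Sum>xs\<in>{xs \<in> ?W. edge_map G \<one> xs = t}. of_rat (Poly_Mapping.lookup f (Word xs)) * m xs) = 0"
          by simp
      qed
      finally show ?thesis .
    qed
    moreover have "subst_mat k \<phi> f \<in> carrier_mat k k"
      by (rule index_subst_mat(1)[OF ord e fin f car ent])
    ultimately show ?thesis by (intro eq_matI) auto
  qed
  show "f \<in> graded_identities G e"
    unfolding graded_identities_def ord mem_Collect_eq
  proof (intro conjI allI impI)
    show "f \<in> carrier (free_algebra (graded_vars G))"
      using f multilinear_words_vars by (fastforce simp: free_algebra_def)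
    fix \<phi> assume *: "\<forall>(i, g)\<in>graded_vars G. \<phi> (i, g) \<in> crossed_component G e g"
    show "subst_mat k \<phi> f = 0\<^sub>m k k"
    proof (rule zero)
      fix x assume "x \<in> graded_vars G"
      with * show "\<phi> x \<in> crossed_component G e (snd x)" by (cases x) auto
    qed
  qed
qed

text \<open>The class sums are coordinates on the quotient; one word for each arc map gives the dual
  vectors.\<close>

lemma graded_codim_eq_card_eulerian:
  assumes ord: "Coset.order G = k" and e: "bij_betw e {..<k} (carrier G)" and fin: "finite (carrier G)"
  shows "graded_codim G e n = card (eulerian_digraphs {1..n} (carrier G) \<one>)"
proof -
  let ?W = "multilinear_words G n"
  let ?V = "(free_algebra (graded_vars G))\<lparr>carrier := multilinear_space G n\<rparr>"
  let ?E = "eulerian_digraphs {1..n} (carrier G) \<one>"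
  let ?N = "multilinear_space G n \<inter> graded_identities G e"
  have V: "vectorspace class_ring ?V"
    unfolding multilinear_space_eq[OF fin] by (rule free_algebra_span_vectorspace)
  interpret V: vectorspace class_ring ?V by (rule V)
  let ?F = "free_algebra (graded_vars G)"
  have V_simps: "f \<oplus>\<^bsub>?F\<^esub> g = f + g" "\<zero>\<^bsub>?F\<^esub> = 0" "c \<odot>\<^bsub>?F\<^esub> f = Poly_Mapping.map ((*) c) f" for f g c
    by (simp_all add: free_algebra_def)
  have N: "f \<in> ?N \<longleftrightarrow> (\<forall>t\<in>?E. class_sum n t f = 0)" if "f \<in> multilinear_space G n" for f
    using that graded_identity_iff[OF ord e fin, of f n] by (simp add: multilinear_space_eq[OF fin])
  have cs_add: "class_sum n t (f + g) = class_sum n t f + class_sum n t g" for t f g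
    by (simp add: class_sum_def lookup_add sum.distrib)
  have cs_smult: "class_sum n t (Poly_Mapping.map ((*) c) f) = c * class_sum n t f" for t c f
    by (simp add: class_sum_def lookup_smult sum_distrib_left)
  have cs_zero: "class_sum n t 0 = 0" for t by (simp add: class_sum_def)
  have sub: "submodule class_ring ?N ?V"
  proof (rule submodule.intro)
    show "module class_ring ?V" ..
    show "?N \<subseteq> carrier ?V" by simp
    show "\<zero>\<^bsub>?V\<^esub> \<in> ?N"
      using N[of 0] V.M.zero_closed by (simp add: V_simps cs_zero)
    show "f \<oplus>\<^bsub>?V\<^esub> g \<in> ?N" if "f \<in> ?N" "g \<in> ?N" for f g
      using that N[of f] N[of g] N[of "f + g"] V.M.a_closed[of f g] by (simp add: V_simps cs_add)
    show "c \<odot>\<^bsub>?V\<^esub> f \<in> ?N" if "c \<in> carrier class_ring" "f \<in> ?N" for c f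
      using that N[of f] N[of "Poly_Mapping.map ((*) c) f"] V.smult_closed[of c f]
      by (simp add: V_simps cs_smult)
  qed
  define r where "r = inv_into ?W (edge_map G \<one>)"
  have r: "r t \<in> ?W" "edge_map G \<one> (r t) = t" if "t \<in> ?E" for t
    using that unfolding r_def edge_map_image_multilinear_words[symmetric]
    by (auto intro: inv_into_into f_inv_into_f)
  have "vectorspace.dim class_ring (quotient_module ?V ?N) = card ?E"
  proof (rule quotient_module_dim[OF V sub, where L = "class_sum n" and b = "\<lambda>t. Poly_Mapping.single (Word (r t)) 1"])
    show "finite ?E" using fin by (intro finite_eulerian_digraphs) auto
    show "Poly_Mapping.single (Word (r t)) 1 \<in> carrier ?V" if "t \<in> ?E" for t
      using r[OF that] by (simp add: multilinear_space_eq[OF fin])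
    show "class_sum n s (Poly_Mapping.single (Word (r t)) 1) = (if s = t then \<one>\<^bsub>class_ring\<^esub> else \<zero>\<^bsub>class_ring\<^esub>)"
      if "s \<in> ?E" "t \<in> ?E" for s t
    proof -
      have "class_sum n s (Poly_Mapping.single (Word (r t)) 1)
          = (\<Sum>xs\<in>{xs \<in> ?W. edge_map G \<one> xs = s}. if r t = xs then 1 else 0)"
        by (simp add: class_sum_def lookup_single when_def)
      also have "\<dots> = (if r t \<in> {xs \<in> ?W. edge_map G \<one> xs = s} then 1 else 0)"
        using finite_multilinear_words[OF fin, of n] by (subst sum.delta') auto
      finally show ?thesis using r[OF that(2)] by auto
    qed
    show "f \<in> ?N \<longleftrightarrow> (\<forall>t\<in>?E. class_sum n t f = \<zero>\<^bsub>class_ring\<^esub>)" if "f \<in> carrier ?V" for f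
      using N[of f] that by simp
  qed (simp_all add: V_simps cs_add cs_smult)
  then show ?thesis by (simp add: graded_codim_def)
qed

end

section \<open>Asymptotics of the graded codimensions\<close>

theorem theorem17:
  fixes G :: "('g, 'b) monoid_scheme" and e :: "nat \<Rightarrow> 'g" and k :: nat
  assumes "group G"
    and "Coset.order G = k"
    and "k \<ge> 2"
    and "bij_betw e {..<k} (carrier G)"
  shows "(\<lambda>n. real (graded_codim G e n)) \<sim>[sequentially]
    (\<lambda>n. real k powr (real k / 2 + 1) / (4 * pi) powr ((real k - 1) / 2)
          * real n powr (- ((real k - 1) / 2)) * real k ^ (2 * n))"
proof -
  interpret group G by fact
  have card: "card (carrier G) = k" using assms(2) by (simp add: Coset.order_def)
  have fin: "finite (carrier G)" using card assms(3) by (intro card_ge_0_finite) simp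
  define \<beta> where "\<beta> = (real k - 1) / 2"
  define C where "C = real k powr (real k / 2) / (4 * pi) powr \<beta>"
  define c where "c n = real (graded_codim G e n)" for n
  define m where "m n = real (sum_sq_multinom k n)" for n
  define q where "q = real (k\<^sup>2 - 1) / real k ^ 2"
  have k: "real k > 0" using assms(3) by simp
  have C: "C > 0" using k by (simp add: C_def)
  have "k\<^sup>2 > 1" using assms(3) by (intro one_less_power) auto
  then have q: "0 < q" "q < 1" using assms(3) by (auto simp: q_def of_nat_diff divide_less_eq)
  have bounds: "real k * c n \<le> m (Suc n)"
    "m (Suc n) \<le> real k * (c n + real k ^ 2 * (real (k\<^sup>2 - 1)) ^ Suc n)" for n
  proof -
    have c: "graded_codim G e n = card (eulerian_digraphs {1..n} (carrier G) \<one>\<^bsub>G\<^esub>)"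
      by (rule graded_codim_eq_card_eulerian[OF assms(2,4) fin])
    note b = card_eulerian_digraphs_bounds[of "{1..n}" "carrier G" "\<one>\<^bsub>G\<^esub>" 0, folded c, unfolded card]
    have "real (k * graded_codim G e n) \<le> real (sum_sq_multinom k (Suc n))"
      using b(1) fin by (intro of_nat_mono) simp
    then show "real k * c n \<le> m (Suc n)" by (simp add: c_def m_def)
    have "real (sum_sq_multinom k (Suc n)) \<le> real (k * (graded_codim G e n + k\<^sup>2 * (k\<^sup>2 - 1) ^ Suc n))"
      using b(2) fin by (intro of_nat_mono) simp
    then show "m (Suc n) \<le> real k * (c n + real k ^ 2 * (real (k\<^sup>2 - 1)) ^ Suc n)"
      by (simp only: c_def m_def of_nat_mult of_nat_add of_nat_power)
  qed
  \<comment> \<open>\<open>r\<close> is the normalised codimension, squeezed between \<open>u - err\<close> and \<open>u\<close>.\<close>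
  define u where "u n = m (Suc n) / real k / real k ^ (2 * n) * real n powr \<beta>" for n
  define r where "r n = c n / real k ^ (2 * n) * real n powr \<beta>" for n
  define err where "err n = real k ^ 2 * real (k\<^sup>2 - 1) * (q ^ n * real n powr \<beta>)" for n
  have lim_u: "u \<longlonglongrightarrow> real k * C"
  proof -
    have "(\<lambda>n. m n / real k ^ (2 * n) * real n powr \<beta>) \<longlonglongrightarrow> C"
      unfolding m_def \<beta>_def C_def using assms(3) by (intro sum_sq_multinom_tendsto) simp
    then have "(\<lambda>n. m (Suc n) / real k ^ (2 * Suc n) * real (Suc n) powr \<beta>) \<longlonglongrightarrow> C"
      by (rule LIMSEQ_Suc)
    moreover have "(\<lambda>n. (real n / real (Suc n)) powr \<beta>) \<longlonglongrightarrow> 1"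
      by real_asymp
    ultimately have "(\<lambda>n. real k * (m (Suc n) / real k ^ (2 * Suc n) * real (Suc n) powr \<beta>) * (real n / real (Suc n)) powr \<beta>)
        \<longlonglongrightarrow> real k * C * 1"
      by (intro tendsto_mult tendsto_const)
    moreover have "real k * (m (Suc n) / real k ^ (2 * Suc n) * real (Suc n) powr \<beta>) * (real n / real (Suc n)) powr \<beta> = u n" for n
    proof -
      have "real (Suc n) powr \<beta> * (real n / real (Suc n)) powr \<beta> = real n powr \<beta>"
        by (simp add: powr_divide)
      moreover have "real k * (m (Suc n) / real k ^ (2 * Suc n)) = m (Suc n) / real k / real k ^ (2 * n)"
        using k by (simp add: power2_eq_square field_simps)
      ultimately show ?thesis unfolding u_def by (metis mult.assoc)
    qed
    ultimately show ?thesis by simp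
  qed
  have lim_err: "err \<longlonglongrightarrow> 0"
  proof -
    have "(\<lambda>n. q ^ n * real n powr \<beta>) \<longlonglongrightarrow> 0" using q by real_asymp
    then show ?thesis unfolding err_def by (rule tendsto_mult_right_zero)
  qed
  have le_u: "r n \<le> u n" for n
  proof -
    have "c n \<le> m (Suc n) / real k" using bounds(1)[of n] k by (simp add: field_simps)
    then show ?thesis unfolding r_def u_def by (intro mult_right_mono divide_right_mono) auto
  qed
  have ge_u: "u n - err n \<le> r n" for n
  proof -
    have "m (Suc n) / real k \<le> c n + real k ^ 2 * (real (k\<^sup>2 - 1)) ^ Suc n"
      using bounds(2)[of n] k by (simp add: divide_le_eq mult.commute)
    then have "u n \<le> (c n + real k ^ 2 * (real (k\<^sup>2 - 1)) ^ Suc n) / real k ^ (2 * n) * real n powr \<beta>"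
      unfolding u_def by (intro mult_right_mono divide_right_mono) auto
    also have "\<dots> = r n + err n"
    proof -
      have "real k ^ (2 * n) = (real k ^ 2) ^ n" by (simp add: power_mult)
      then show ?thesis
        unfolding r_def err_def q_def by (simp only:) (simp add: add_divide_distrib power_divide algebra_simps)
    qed
    finally show ?thesis by simp
  qed
  have "r \<longlonglongrightarrow> real k * C"
  proof (rule tendsto_sandwich[OF _ _ _ lim_u])
    show "(\<lambda>n. u n - err n) \<longlonglongrightarrow> real k * C"
      using tendsto_diff[OF lim_u lim_err] by simp
  qed (use le_u ge_u in simp_all)
  then have "(\<lambda>n. r n / (real k * C)) \<longlonglongrightarrow> real k * C / (real k * C)"
    using k C by (intro tendsto_divide tendsto_const) auto
  then have lim: "(\<lambda>n. r n / (real k * C)) \<longlonglongrightarrow> 1" using k C by simp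
  have K: "real k powr (real k / 2 + 1) / (4 * pi) powr ((real k - 1) / 2) = real k * C"
    using k by (simp add: C_def \<beta>_def powr_add)
  show ?thesis
    unfolding K
  proof (rule asymp_equivI', rule Lim_transform_eventually[OF lim])
    show "\<forall>\<^sub>F n in sequentially. r n / (real k * C) = real (graded_codim G e n) /
        (real k * C * real n powr (- ((real k - 1) / 2)) * real k ^ (2 * n))"
      using eventually_gt_at_top[of 0]
    proof eventually_elim
      case (elim n)
      then show ?case
        using k C unfolding r_def c_def \<beta>_def[symmetric] by (simp add: powr_minus field_simps)
    qed
  qed
qed

end
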